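(* Fix a known positive definite matrix $\Sigma\in\mathbb{R}^{d\times d}$ and consider the class $\mathcal{D}^{\mathsf{N}}_{\Sigma}=\{\mathsf{N}(\mu,\Sigma)\mid \mu\in\mathbb{R}^d\}$. For all privacy parameters $\epsilon\in(0,1]$, $\delta\in(0,1/2]$ and accuracy $\alpha\in(0,1/2]$, there is an $\alpha$-accurate $(\epsilon,\delta)$-differentially private sampler for $\mathcal{D}^{\mathsf{N}}_{\Sigma}$ with sample complexity $$O\left(\frac{\sqrt{d}}{\epsilon}\cdot \mathrm{polylog}\left(\frac{d}{\delta\epsilon\alpha}\right)\right).$$
   Context: $\mathsf{N}(\mu,\Sigma)$ denotes the Gaussian on $\mathbb{R}^d$ with density proportional to $\exp(-\frac12(x-\mu)^T\Sigma^{-1}(x-\mu))$. A sampler with sample complexity $n$ for a class $\mathcal{D}$ of distributions on a domain $\mathcal{X}$ is a (randomized) algorithm $\mathcal{A}$ that receives $n$ i.i.d. samples $\mathbf{X}\sim D^n$ from an unknown $D\in\mathcal{D}$ and outputs an element of $\mathcal{X}$; letting $Q_{\mathcal{A},D}$ be the distribution of $\mathcal{A}(\mathbf{X})$ with $\mathbf{X}\sim D^n$, the sampler is $\alpha$-accurate if $d_{\mathrm{tv}}(D,Q_{\mathcal{A},D})\le\alpha$ for all $D\in\mathcal{D}$. Datasets are neighbors if they have the same size and differ in exactly one element (substitution). An algorithm $\mathcal{M}$ is $(\epsilon,\delta)$-DP if for all neighboring datasets $Y,Y'$ and all measurable sets $S$ of outputs, $\Pr[\mathcal{M}(Y)\in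 S]\le e^{\epsilon}\Pr[\mathcal{M}(Y')\in S]+\delta$. $\mathrm{polylog}(x)$ denotes a quantity bounded by a polynomial in $\log x$. The covariance $\Sigma$ is known to the algorithm; $\mu$ is unknown. *)

theory Defs
  imports
    "HOL-Probability.Probability"
    "HOL-Computational_Algebra.Polynomial"
    "Jordan_Normal_Form.Gauss_Jordan_Elimination"
begin

hide_const (open) Finite_Cartesian_Product.vec Finite_Cartesian_Product.mat

section \<open>Samplers and differential privacy\<close>

text \<open>A dataset of size \<open>n\<close> over the domain \<open>X\<close> is a point of the \<open>n\<close>-fold product space.
  A randomized algorithm is a Markov kernel, given by the output distribution on each dataset.\<close>

abbreviation datasets :: "'a measure \<Rightarrow> nat \<Rightarrow> (nat \<Rightarrow> 'a) measure" where
  "datasets X n \<equiv> PiM {..<n} (\<lambda>_. X)"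

definition randomized_algorithm ::
    "'a measure \<Rightarrow> nat \<Rightarrow> 'b measure \<Rightarrow> ((nat \<Rightarrow> 'a) \<Rightarrow> 'b measure) \<Rightarrow> bool" where
  "randomized_algorithm X n Y A \<longleftrightarrow> A \<in> datasets X n \<rightarrow>\<^sub>M prob_algebra Y"

definition neighbors :: "'a measure \<Rightarrow> nat \<Rightarrow> (nat \<Rightarrow> 'a) \<Rightarrow> (nat \<Rightarrow> 'a) \<Rightarrow> bool" where
  "neighbors X n y y' \<longleftrightarrow>
     y \<in> space (datasets X n) \<and> y' \<in> space (datasets X n) \<and> card {i \<in> {..<n}. y i \<noteq> y' i} = 1"

definition differentially_private ::
    "'a measure \<Rightarrow> nat \<Rightarrow> 'b measure \<Rightarrow> real \<Rightarrow> real \<Rightarrow> ((nat \<Rightarrow> 'a) \<Rightarrow> 'b measure) \<Rightarrow> bool" where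
  "differentially_private X n Y \<epsilon> \<delta> A \<longleftrightarrow>
     (\<forall>y y'. neighbors X n y y' \<longrightarrow>
        (\<forall>S \<in> sets Y. measure (A y) S \<le> exp \<epsilon> * measure (A y') S + \<delta>))"

text \<open>Only meant for two probability measures on the same \<open>\<sigma>\<close>-algebra.\<close>

definition tv_dist :: "'a measure \<Rightarrow> 'a measure \<Rightarrow> real" where
  "tv_dist P Q = (SUP S \<in> sets P. \<bar>measure P S - measure Q S\<bar>)"

text \<open>The distribution of the output of \<open>A\<close> on \<open>n\<close> independent samples from \<open>D\<close>, taken over
  both the samples and the internal randomness of \<open>A\<close>.\<close>

definition output_dist :: "nat \<Rightarrow> ((nat \<Rightarrow> 'a) \<Rightarrow> 'b measure) \<Rightarrow> 'a measure \<Rightarrow> 'b measure" where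
  "output_dist n A D = PiM {..<n} (\<lambda>_. D) \<bind> A"

definition accurate_sampler ::
    "'a measure \<Rightarrow> nat \<Rightarrow> 'a measure set \<Rightarrow> real \<Rightarrow> ((nat \<Rightarrow> 'a) \<Rightarrow> 'a measure) \<Rightarrow> bool" where
  "accurate_sampler X n \<D> \<alpha> A \<longleftrightarrow>
     randomized_algorithm X n X A \<and> (\<forall>D \<in> \<D>. tv_dist D (output_dist n A D) \<le> \<alpha>)"

section \<open>Gaussians on \<open>\<real>\<^sup>d\<close>\<close>

text \<open>The dimension has to be a term rather than a type, because the constants in the sample
  complexity bound must not depend on it. So points of \<open>\<real>\<^sup>d\<close> are the elements of the extensional
  product \<open>{..<d} \<rightarrow>\<^sub>E UNIV\<close>, with the Borel product \<open>\<sigma>\<close>-algebra and the product Lebesgue measure;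
  they are turned into vectors where linear algebra is needed.\<close>

abbreviation euclid :: "nat \<Rightarrow> (nat \<Rightarrow> real) measure" where
  "euclid d \<equiv> PiM {..<d} (\<lambda>_. borel)"

abbreviation euclid_lborel :: "nat \<Rightarrow> (nat \<Rightarrow> real) measure" where
  "euclid_lborel d \<equiv> PiM {..<d} (\<lambda>_. lborel)"

definition positive_definite :: "nat \<Rightarrow> real mat \<Rightarrow> bool" where
  "positive_definite d \<Sigma> \<longleftrightarrow>
     \<Sigma> \<in> carrier_mat d d \<and> transpose_mat \<Sigma> = \<Sigma> \<and>
     (\<forall>v \<in> carrier_vec d. v \<noteq> 0\<^sub>v d \<longrightarrow> v \<bullet> (\<Sigma> *\<^sub>v v) > 0)"

definition gaussian_weight ::
    "nat \<Rightarrow> (nat \<Rightarrow> real) \<Rightarrow> real mat \<Rightarrow> (nat \<Rightarrow> real) \<Rightarrow> real" where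
  "gaussian_weight d \<mu> \<Sigma> x =
     (let v = vec d (\<lambda>i. x i - \<mu> i) in exp (- (1/2) * (v \<bullet> (the (mat_inverse \<Sigma>) *\<^sub>v v))))"

definition gaussian :: "nat \<Rightarrow> (nat \<Rightarrow> real) \<Rightarrow> real mat \<Rightarrow> (nat \<Rightarrow> real) measure" where
  "gaussian d \<mu> \<Sigma> =
     density (euclid_lborel d)
       (\<lambda>x. ennreal (gaussian_weight d \<mu> \<Sigma> x /
                     (\<integral>z. gaussian_weight d \<mu> \<Sigma> z \<partial>euclid_lborel d)))"

definition gaussian_class :: "nat \<Rightarrow> real mat \<Rightarrow> (nat \<Rightarrow> real) measure set" where
  "gaussian_class d \<Sigma> = {gaussian d \<mu> \<Sigma> | \<mu>. \<mu> \<in> space (euclid d)}"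

section \<open>Polylogarithmic quantities\<close>

definition polylog :: "(real \<Rightarrow> real) \<Rightarrow> bool" where
  "polylog g \<longleftrightarrow> (\<exists>p :: real poly. \<forall>x \<ge> 1. \<bar>g x\<bar> \<le> poly p (ln x))"

end

theory Submission
  imports Defs "Jordan_Normal_Form.Determinant"
begin

text \<open>
  With \<open>\<sigma> = 1 - 1 / n\<close>, adding noise \<open>N(0, \<sigma> \<Sigma>)\<close> to the empirical mean of \<open>n\<close> samples of
  \<open>N(\<mu>, \<Sigma>)\<close> produces exactly \<open>N(\<mu>, \<Sigma>)\<close>. To make the mean insensitive to a single sample although
  \<open>\<mu>\<close> is unbounded, every sample is weighted by how far the number of samples at distance at most
  \<open>r\<close> from it (in the norm \<open>\<parallel>v\<parallel>\<^sup>2 = v\<^sup>T \<Sigma>\<^sup>-\<^sup>1 v\<close>) exceeds \<open>3 n / 4\<close>. Two samples of positive weight share a neighbor,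
  so the weighted mean has sensitivity \<open>O(r / n)\<close> as soon as the total weight, itself of sensitivity
  \<open>5\<close>, is at least \<open>n / 2\<close>. The noisy weighted mean is released with a probability depending on the
  total weight through a truncated logistic function; otherwise \<open>N(0, \<sigma> \<Sigma>)\<close> is sampled. On
  typical data, with \<open>r = O(sqrt d ln (d / (\<delta> \<epsilon> \<alpha>)))\<close>, all weights equal \<open>1\<close>.
  Everything is done with the quadratic form of \<open>\<Sigma>\<^sup>-\<^sup>1\<close> and the translation and scaling behaviour of
  Lebesgue measure; neither \<open>\<Sigma>\<close> nor its determinant has to be decomposed.
\<close>

section \<open>Affine changes of variables for product Lebesgue measure\<close>

text \<open>Product measures are determined by their values on boxes, and on a box every coordinate
  contributes one factor \<open>\<bar>c\<bar>\<close> by the one-dimensional rule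
  \<open>lborel_real_affine\<close>.\<close>

lemma euclid_lborel_affine:
  assumes c: "c \<noteq> (0::real)"
  shows "euclid_lborel d =
    density (distr (euclid_lborel d) (euclid_lborel d) (\<lambda>x. \<lambda>i\<in>{..<d}. t i + c * x i)) (\<lambda>_. ennreal (\<bar>c\<bar> ^ d))"
proof -
  interpret product_sigma_finite "\<lambda>_::nat. lborel :: real measure" ..
  let ?E = "euclid_lborel d"
  let ?T = "\<lambda>x. \<lambda>i\<in>{..<d}. t i + c * x i"
  have T[measurable]: "?T \<in> ?E \<rightarrow>\<^sub>M ?E"
    by (intro measurable_restrict) simp
  have "density (distr ?E ?E ?T) (\<lambda>_. ennreal (\<bar>c\<bar> ^ d)) = ?E"
  proof (rule PiM_eqI)
    fix A :: "nat \<Rightarrow> real set"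
    assume A: "\<And>i. i \<in> {..<d} \<Longrightarrow> A i \<in> sets lborel"
    let ?A = "\<lambda>i. (\<lambda>x. t i + c * x) -` A i"
    have A': "?A i \<in> sets lborel" if "i < d" for i
    proof -
      have "A i \<in> sets borel" using A that by simp
      then have "?A i \<in> sets borel"
        by (rule measurable_sets_borel[rotated]) measurable
      then show ?thesis by simp
    qed
    have PA: "Pi\<^sub>E {..<d} A \<in> sets ?E" using A by (intro sets_PiM_I_finite) auto
    have one: "ennreal \<bar>c\<bar> * emeasure lborel (?A i) = emeasure lborel (A i)" if i: "i < d" for i
    proof -
      have Ai: "A i \<in> sets borel" using A i by simp
      show ?thesis
        using Ai by (subst (2) lborel_real_affine[OF c, of "t i"])
          (simp add: emeasure_density_const emeasure_distr)
    qed
    have "emeasure (density (distr ?E ?E ?T) (\<lambda>_. ennreal (\<bar>c\<bar> ^ d))) (Pi\<^sub>E {..<d} A)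
        = ennreal (\<bar>c\<bar> ^ d) * emeasure ?E (?T -` (Pi\<^sub>E {..<d} A) \<inter> space ?E)"
      using PA by (simp add: emeasure_density_const emeasure_distr)
    also have "?T -` (Pi\<^sub>E {..<d} A) \<inter> space ?E = Pi\<^sub>E {..<d} ?A"
      by (auto simp: space_PiM PiE_iff)
    also have "emeasure ?E (Pi\<^sub>E {..<d} ?A) = (\<Prod>i<d. emeasure lborel (?A i))"
      using A' by (intro emeasure_PiM) auto
    also have "ennreal (\<bar>c\<bar> ^ d) * (\<Prod>i<d. emeasure lborel (?A i)) = (\<Prod>i<d. emeasure lborel (A i))"
    proof -
      have "ennreal (\<bar>c\<bar> ^ d) = (\<Prod>i<d. ennreal \<bar>c\<bar>)"
        by (simp add: ennreal_power)
      then show ?thesis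
        unfolding prod.distrib[symmetric] using one
        by (simp only: flip: prod.distrib) (intro prod.cong; simp)
    qed
    finally show "emeasure (density (distr ?E ?E ?T) (\<lambda>_. ennreal (\<bar>c\<bar> ^ d))) (Pi\<^sub>E {..<d} A)
        = (\<Prod>i<d. emeasure lborel (A i))" .
  qed auto
  then show ?thesis by simp
qed

lemma nn_integral_euclid_affine:
  assumes f[measurable]: "f \<in> borel_measurable (euclid_lborel d)" and c: "c \<noteq> (0::real)"
  shows "(\<integral>\<^sup>+x. f x \<partial>euclid_lborel d) =
    ennreal (\<bar>c\<bar> ^ d) * (\<integral>\<^sup>+x. f (\<lambda>i\<in>{..<d}. t i + c * x i) \<partial>euclid_lborel d)"
proof -
  have T[measurable]: "(\<lambda>x. \<lambda>i\<in>{..<d}. t i + c * x i) \<in> euclid_lborel d \<rightarrow>\<^sub>M euclid_lborel d"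
    by (intro measurable_restrict) simp
  show ?thesis
    by (subst euclid_lborel_affine[OF c, of d t])
      (simp add: nn_integral_density nn_integral_distr nn_integral_cmult)
qed

section \<open>Positive definite quadratic forms and their norms\<close>

text \<open>\<open>P\<close> stands for the entries of the inverse covariance. Definiteness is
  assumed with a uniform constant, since this directly dominates the Gaussian weight by a product of
  one-dimensional ones.\<close>

locale pd_form =
  fixes d :: nat and P :: "nat \<Rightarrow> nat \<Rightarrow> real"
  assumes sym: "i < d \<Longrightarrow> j < d \<Longrightarrow> P i j = P j i"
    and coercive: "\<exists>c>0. \<forall>x. c * (\<Sum>i<d. (x i)\<^sup>2) \<le> (\<Sum>i<d. \<Sum>j<d. P i j * x i * x j)"
begin

definition bilin :: "(nat \<Rightarrow> real) \<Rightarrow> (nat \<Rightarrow> real) \<Rightarrow> real" where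
  "bilin x y = (\<Sum>i<d. \<Sum>j<d. P i j * x i * y j)"

abbreviation q :: "(nat \<Rightarrow> real) \<Rightarrow> real" where
  "q x \<equiv> bilin x x"

definition qnorm :: "(nat \<Rightarrow> real) \<Rightarrow> real" where
  "qnorm x = sqrt (q x)"

text \<open>Points of \<open>euclid_lborel d\<close> are \<open>undefined\<close> from coordinate
  \<open>d\<close> on, while pointwise sums and multiples need not be. The form sees only the first
  \<open>d\<close> coordinates, so the two kinds of functions can be exchanged.\<close>

lemma bilin_cong: "(\<And>i. i < d \<Longrightarrow> x i = x' i) \<Longrightarrow> (\<And>i. i < d \<Longrightarrow> y i = y' i) \<Longrightarrow> bilin x y = bilin x' y'"
  unfolding bilin_def by (intro sum.cong) auto

lemma bilin_sym: "bilin x y = bilin y x"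
proof -
  have "bilin x y = (\<Sum>j<d. \<Sum>i<d. P i j * x i * y j)"
    unfolding bilin_def by (rule sum.swap)
  also have "\<dots> = bilin y x"
    unfolding bilin_def using sym by (intro sum.cong) auto
  finally show ?thesis .
qed

lemma bilin_lin: "bilin (\<lambda>i. a * x i + b * y i) z = a * bilin x z + b * bilin y z"
  unfolding bilin_def by (simp add: sum_distrib_left sum.distrib[symmetric] algebra_simps)

lemma q_lin: "q (\<lambda>i. a * x i + b * y i) = a\<^sup>2 * q x + 2 * a * b * bilin x y + b\<^sup>2 * q y"
proof -
  have "q (\<lambda>i. a * x i + b * y i)
      = a * bilin (\<lambda>i. a * x i + b * y i) x + b * bilin (\<lambda>i. a * x i + b * y i) y"
    by (subst bilin_lin) (simp add: bilin_sym[of _ "\<lambda>i. a * x i + b * y i"])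
  then show ?thesis
    by (simp add: bilin_lin bilin_sym[of y x] power2_eq_square algebra_simps)
qed

lemma q_diff: "q (\<lambda>i. x i - y i) = q x - 2 * bilin x y + q y"
  using q_lin[of 1 x "-1" y] by simp

lemma q_scale: "q (\<lambda>i. a * x i) = a\<^sup>2 * q x"
  using q_lin[of a x 0 x] by simp

lemma q_nonneg: "0 \<le> q x"
proof -
  obtain c where "c > 0" and "c * (\<Sum>i<d. (x i)\<^sup>2) \<le> q x"
    using coercive unfolding bilin_def by auto
  moreover have "0 \<le> c * (\<Sum>i<d. (x i)\<^sup>2)"
    using \<open>c > 0\<close> by (intro mult_nonneg_nonneg sum_nonneg) auto
  ultimately show ?thesis by linarith
qed

lemma qnorm_nonneg: "0 \<le> qnorm x"
  by (simp add: qnorm_def q_nonneg)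

lemma qnorm_square: "(qnorm x)\<^sup>2 = q x"
  by (simp add: qnorm_def q_nonneg)

text \<open>Nonnegativity of the form at \<open>qnorm y * x - qnorm x * y\<close> is the claim
  multiplied by \<open>2 * qnorm x * qnorm y\<close>. If a norm vanishes, this factor cannot be
  cancelled, and \<open>zero\<close> takes over.\<close>

lemma cauchy_schwarz: "bilin x y \<le> qnorm x * qnorm y"
proof -
  have "0 \<le> q (\<lambda>i. qnorm y * x i + (- qnorm x) * y i)" by (rule q_nonneg)
  then have "2 * (qnorm x * qnorm y) * bilin x y \<le> 2 * (qnorm x * qnorm y) * (qnorm x * qnorm y)"
    unfolding q_lin by (simp add: qnorm_square[symmetric] power2_eq_square algebra_simps)
  then have *: "bilin x y \<le> qnorm x * qnorm y" if "qnorm x > 0" "qnorm y > 0"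
    using that by (simp add: mult_le_cancel_left)
  have zero: "bilin x y \<le> 0" if x: "q x = 0" for x y
  proof (rule ccontr)
    assume "\<not> bilin x y \<le> 0"
    then have b: "bilin x y > 0" by simp
    \<comment> \<open>As \<open>q x = 0\<close>, the form at \<open>a * x + y\<close> is affine in
      \<open>a\<close>; this \<open>a\<close> gives it the impossible value -1.\<close>
    define a where "a = - (q y + 1) / (2 * bilin x y)"
    have "0 \<le> q (\<lambda>i. a * x i + 1 * y i)" by (rule q_nonneg)
    also have "\<dots> = 2 * a * bilin x y + q y" unfolding q_lin using x by simp
    also have "\<dots> = -1" using b by (simp add: a_def field_simps)
    finally show False by simp
  qed
  show ?thesis
  proof (cases "qnorm x > 0 \<and> qnorm y > 0")
    case False
    then have "qnorm x = 0 \<or> qnorm y = 0" using qnorm_nonneg[of x] qnorm_nonneg[of y] by auto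
    moreover from this have "q x = 0 \<or> q y = 0" by (metis qnorm_square zero_power2)
    ultimately show ?thesis using zero[of x y] zero[of y x] bilin_sym[of x y] by auto
  qed (use * in auto)
qed

lemma qnorm_triangle: "qnorm (\<lambda>i. x i + y i) \<le> qnorm x + qnorm y"
proof (rule power2_le_imp_le)
  have "q (\<lambda>i. x i + y i) = q x + 2 * bilin x y + q y"
    using q_lin[of 1 x 1 y] by simp
  then show "(qnorm (\<lambda>i. x i + y i))\<^sup>2 \<le> (qnorm x + qnorm y)\<^sup>2"
    using cauchy_schwarz[of x y] by (simp add: qnorm_square power2_sum)
qed (simp add: qnorm_nonneg)

lemma qnorm_scale: "qnorm (\<lambda>i. a * x i) = \<bar>a\<bar> * qnorm x"
  by (simp add: qnorm_def q_scale real_sqrt_mult)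

lemma qnorm_minus: "qnorm (\<lambda>i. x i - y i) = qnorm (\<lambda>i. y i - x i)"
  by (simp add: qnorm_def q_diff bilin_sym[of x y])

lemma qnorm_triangle': "qnorm (\<lambda>i. x i - z i) \<le> qnorm (\<lambda>i. x i - y i) + qnorm (\<lambda>i. y i - z i)"
  using qnorm_triangle[of "\<lambda>i. x i - y i" "\<lambda>i. y i - z i"] by simp

lemma qnorm_sum:
  assumes "finite A"
  shows "qnorm (\<lambda>i. \<Sum>j\<in>A. a j * u j i) \<le> (\<Sum>j\<in>A. \<bar>a j\<bar> * qnorm (u j))"
  using assms
proof induction
  case empty
  show ?case by (simp add: qnorm_def bilin_def)
next
  case (insert k A)
  then show ?case
    using qnorm_triangle[of "\<lambda>i. a k * u k i" "\<lambda>i. \<Sum>j\<in>A. a j * u j i"] by (simp add: qnorm_scale)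
qed

lemma measurable_bilin:
  assumes "\<And>i. i < d \<Longrightarrow> (\<lambda>w. f w i) \<in> borel_measurable M"
    and "\<And>i. i < d \<Longrightarrow> (\<lambda>w. h w i) \<in> borel_measurable M"
  shows "(\<lambda>w. bilin (f w) (h w)) \<in> borel_measurable M"
  unfolding bilin_def using assms
  by (intro borel_measurable_sum borel_measurable_times borel_measurable_const) auto

lemma measurable_coord [measurable]: "i < d \<Longrightarrow> (\<lambda>x. x i) \<in> borel_measurable (euclid_lborel d)"
  using measurable_component_singleton[of i "{..<d}" "\<lambda>_. lborel"] by simp

section \<open>Gaussian densities whose covariance is a multiple of the fixed one\<close>

text \<open>The normalizing constant is never evaluated, which would require a determinant: its
  positivity and its dependence on \<open>s\<close> suffice.\<close>

definition gauss_mass :: "real \<Rightarrow> real" where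
  "gauss_mass s = (\<integral>x. exp (- q x / (2 * s)) \<partial>euclid_lborel d)"

text \<open>For \<open>P\<close> the inverse of \<Sigma> and \<open>s > 0\<close>, this is the
  density of N(m, s \<Sigma>).\<close>

definition gauss_dens :: "real \<Rightarrow> (nat \<Rightarrow> real) \<Rightarrow> (nat \<Rightarrow> real) \<Rightarrow> real" where
  "gauss_dens s m x = exp (- q (\<lambda>i. x i - m i) / (2 * s)) / gauss_mass s"

lemma measurable_q_diff [measurable]:
  "(\<lambda>x. q (\<lambda>i. x i - m i)) \<in> borel_measurable (euclid_lborel d)"
  by (intro measurable_bilin) measurable

lemma measurable_q [measurable]: "q \<in> borel_measurable (euclid_lborel d)"
  using measurable_q_diff[of "\<lambda>_. 0"] by simp

lemma integrable_exp_q: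
  assumes "s > 0"
  shows "integrable (euclid_lborel d) (\<lambda>x. exp (- q x / (2 * s)))"
proof -
  interpret product_sigma_finite "\<lambda>_::nat. lborel :: real measure" ..
  obtain c where c: "c > 0" "\<And>x. c * (\<Sum>i<d. (x i)\<^sup>2) \<le> q x"
    using coercive unfolding bilin_def by auto
  \<comment> \<open>The variance \<open>s / c\<close> turns the normal density into a multiple of
    \<open>exp (- (c * x\<^sup>2) / (2 * s))\<close>, the one-dimensional factor of the dominating
    product.\<close>
  define \<sigma> where "\<sigma> = sqrt (s / c)"
  have \<sigma>: "\<sigma> > 0" using c assms by (simp add: \<sigma>_def)
  have "integrable lborel (\<lambda>x. sqrt (2 * pi * \<sigma>\<^sup>2) * normal_density 0 \<sigma> x)"
    using \<sigma> by simp
  also have "(\<lambda>x. sqrt (2 * pi * \<sigma>\<^sup>2) * normal_density 0 \<sigma> x) = (\<lambda>x. exp (- (c * x\<^sup>2) / (2 * s)))"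
    using \<sigma> c assms by (auto simp: normal_density_def fun_eq_iff \<sigma>_def)
  finally have "integrable lborel (\<lambda>x. exp (- (c * x\<^sup>2) / (2 * s)))" .
  then have "integrable (euclid_lborel d) (\<lambda>x. \<Prod>i<d. exp (- (c * (x i)\<^sup>2) / (2 * s)))"
    by (intro product_integrable_prod) auto
  then show ?thesis
  proof (rule Bochner_Integration.integrable_bound)
    have "exp (- q x / (2 * s)) \<le> (\<Prod>i<d. exp (- (c * (x i)\<^sup>2) / (2 * s)))" for x
    proof -
      have "- q x / (2 * s) \<le> - (c * (\<Sum>i<d. (x i)\<^sup>2)) / (2 * s)"
        using c(2)[of x] assms by (simp add: divide_right_mono)
      then show ?thesis
        by (simp add: exp_sum[symmetric] sum_negf sum_divide_distrib sum_distrib_left)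
    qed
    then show "AE x in euclid_lborel d. norm (exp (- q x / (2 * s)))
        \<le> norm (\<Prod>i<d. exp (- (c * (x i)\<^sup>2) / (2 * s)))"
      by (simp add: prod_nonneg)
  qed measurable
qed

text \<open>A vanishing integral of a strictly positive function would make the whole space a null
  set, but the unit cube has measure 1.\<close>

lemma gauss_mass_pos:
  assumes "s > 0"
  shows "gauss_mass s > 0"
proof -
  interpret product_sigma_finite "\<lambda>_::nat. lborel :: real measure" ..
  have "gauss_mass s \<noteq> 0"
  proof
    assume "gauss_mass s = 0"
    then have "AE x in euclid_lborel d. exp (- q x / (2 * s)) = 0"
      unfolding gauss_mass_def using integral_nonneg_eq_0_iff_AE[OF integrable_exp_q[OF assms]] by simp
    then have "AE x in euclid_lborel d. False" by simp
    then have "emeasure (euclid_lborel d) (space (euclid_lborel d)) = 0"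
      by (simp add: ae_filter_eq_bot_iff trivial_limit_def[symmetric])
    moreover have "emeasure (euclid_lborel d) (Pi\<^sub>E {..<d} (\<lambda>_. {0..1})) = 1"
      by (subst emeasure_PiM) auto
    moreover have "emeasure (euclid_lborel d) (Pi\<^sub>E {..<d} (\<lambda>_. {0..1}))
        \<le> emeasure (euclid_lborel d) (space (euclid_lborel d))"
      by (rule emeasure_space)
    ultimately show False by simp
  qed
  moreover have "gauss_mass s \<ge> 0" unfolding gauss_mass_def by (intro integral_nonneg_AE) simp
  ultimately show ?thesis by simp
qed

lemma nn_integral_exp_q:
  assumes "s > 0"
  shows "(\<integral>\<^sup>+x. ennreal (exp (- q (\<lambda>i. x i - m i) / (2 * s))) \<partial>euclid_lborel d) = ennreal (gauss_mass s)"
proof -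
  have "(\<integral>\<^sup>+x. ennreal (exp (- q (\<lambda>i. x i - m i) / (2 * s))) \<partial>euclid_lborel d)
    = (\<integral>\<^sup>+x. ennreal (exp (- q (\<lambda>i. (\<lambda>i\<in>{..<d}. m i + 1 * x i) i - m i) / (2 * s))) \<partial>euclid_lborel d)"
    by (subst nn_integral_euclid_affine[where c=1 and t=m]) simp_all
  also have "\<dots> = (\<integral>\<^sup>+x. ennreal (exp (- q x / (2 * s))) \<partial>euclid_lborel d)"
    by (intro nn_integral_cong arg_cong[where f="\<lambda>x. ennreal (exp (- x / (2 * s)))"] bilin_cong) auto
  also have "\<dots> = ennreal (gauss_mass s)"
    unfolding gauss_mass_def by (rule nn_integral_eq_integral[OF integrable_exp_q[OF assms]]) simp
  finally show ?thesis .
qed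

lemma gauss_mass_scale:
  assumes "s > 0" "a > 0"
  shows "gauss_mass (a * s) = sqrt a ^ d * gauss_mass s"
proof -
  have "ennreal (gauss_mass (a * s)) = (\<integral>\<^sup>+x. ennreal (exp (- q x / (2 * (a * s)))) \<partial>euclid_lborel d)"
    using nn_integral_exp_q[of "a * s" "\<lambda>_. 0"] assms by simp
  also have "\<dots> = ennreal (sqrt a ^ d) *
      (\<integral>\<^sup>+x. ennreal (exp (- q (\<lambda>i\<in>{..<d}. 0 + sqrt a * x i) / (2 * (a * s)))) \<partial>euclid_lborel d)"
    using assms by (subst nn_integral_euclid_affine[where c="sqrt a" and t="\<lambda>_. 0"]) simp_all
  also have "(\<integral>\<^sup>+x. ennreal (exp (- q (\<lambda>i\<in>{..<d}. 0 + sqrt a * x i) / (2 * (a * s)))) \<partial>euclid_lborel d)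
      = (\<integral>\<^sup>+x. ennreal (exp (- q x / (2 * s))) \<partial>euclid_lborel d)"
  proof (intro nn_integral_cong)
    fix x :: "nat \<Rightarrow> real"
    have "q (\<lambda>i\<in>{..<d}. 0 + sqrt a * x i) = q (\<lambda>i. sqrt a * x i)"
      by (rule bilin_cong) auto
    then show "ennreal (exp (- q (\<lambda>i\<in>{..<d}. 0 + sqrt a * x i) / (2 * (a * s))))
        = ennreal (exp (- q x / (2 * s)))"
      using assms by (simp add: q_scale)
  qed
  also have "\<dots> = ennreal (gauss_mass s)"
    using nn_integral_exp_q[of s "\<lambda>_. 0"] assms by simp
  finally show ?thesis
    using gauss_mass_pos[of s] gauss_mass_pos[of "a * s"] assms by (simp flip: ennreal_mult')
qed

lemma measurable_gauss_dens:
  assumes [measurable]: "\<And>i. i < d \<Longrightarrow> (\<lambda>w. m w i) \<in> borel_measurable M"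
    and [measurable]: "\<And>i. i < d \<Longrightarrow> (\<lambda>w. x w i) \<in> borel_measurable M"
  shows "(\<lambda>w. gauss_dens s (m w) (x w)) \<in> borel_measurable M"
proof -
  have [measurable]: "(\<lambda>w. q (\<lambda>i. x w i - m w i)) \<in> borel_measurable M"
    by (intro measurable_bilin) simp_all
  show ?thesis unfolding gauss_dens_def by measurable
qed

lemma measurable_gauss_dens_point [measurable]: "gauss_dens s m \<in> borel_measurable (euclid_lborel d)"
  by (rule measurable_gauss_dens) simp_all

lemma gauss_dens_pos: "s > 0 \<Longrightarrow> 0 < gauss_dens s m x"
  by (simp add: gauss_dens_def gauss_mass_pos)

lemma gauss_dens_nonneg: "s > 0 \<Longrightarrow> 0 \<le> gauss_dens s m x"
  by (intro less_imp_le gauss_dens_pos)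

lemma nn_integral_gauss_dens:
  assumes "s > 0"
  shows "(\<integral>\<^sup>+x. ennreal (gauss_dens s m x) \<partial>euclid_lborel d) = 1"
proof -
  have "(\<integral>\<^sup>+x. ennreal (gauss_dens s m x) \<partial>euclid_lborel d)
      = (\<integral>\<^sup>+x. ennreal (1 / gauss_mass s) * ennreal (exp (- q (\<lambda>i. x i - m i) / (2 * s))) \<partial>euclid_lborel d)"
    using gauss_mass_pos[OF assms] by (intro nn_integral_cong) (simp add: gauss_dens_def flip: ennreal_mult)
  also have "\<dots> = ennreal (1 / gauss_mass s) * ennreal (gauss_mass s)"
    by (simp add: nn_integral_cmult nn_integral_exp_q[OF assms, simplified])
  also have "\<dots> = 1"
    using gauss_mass_pos[OF assms] by (simp flip: ennreal_mult)
  finally show ?thesis .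
qed

definition gauss :: "real \<Rightarrow> (nat \<Rightarrow> real) \<Rightarrow> (nat \<Rightarrow> real) measure" where
  "gauss s m = density (euclid_lborel d) (\<lambda>x. ennreal (gauss_dens s m x))"

lemma sets_gauss [measurable_cong, simp]: "sets (gauss s m) = sets (euclid_lborel d)"
  by (simp add: gauss_def)

lemma space_gauss [simp]: "space (gauss s m) = space (euclid_lborel d)"
  by (simp add: gauss_def)

lemma prob_space_gauss: "s > 0 \<Longrightarrow> prob_space (gauss s m)"
  unfolding gauss_def by (intro prob_spaceI) (simp add: emeasure_density nn_integral_gauss_dens)

lemma emeasure_gauss: "S \<in> sets (euclid_lborel d) \<Longrightarrow>
    emeasure (gauss s m) S = (\<integral>\<^sup>+x. ennreal (gauss_dens s m x) * indicator S x \<partial>euclid_lborel d)"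
  unfolding gauss_def by (simp add: emeasure_density)

text \<open>If X is distributed as N(\<mu>, \<Sigma>), then a X + c plus independent noise N(0, s
  \<Sigma>) is again Gaussian. The proof completes the square in \<open>x\<close>, so that the
  integral over \<open>x\<close> becomes a normalizing constant.\<close>

lemma gauss_dens_convolution:
  assumes s: "s > 0"
  shows "(\<integral>\<^sup>+x. ennreal (gauss_dens 1 \<mu> x) * ennreal (gauss_dens s (\<lambda>i. a * x i + c i) z) \<partial>euclid_lborel d)
    = ennreal (gauss_dens (s + a\<^sup>2) (\<lambda>i. a * \<mu> i + c i) z)"
proof -
  have sa: "s + a\<^sup>2 > 0" using s by (simp add: add_pos_nonneg)
  \<comment> \<open>Given the outcome \<open>z\<close>, the variable \<open>x\<close> is Gaussian
    with mean \<open>\<mu> + b * v\<close> and covariance t \<Sigma>.\<close>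
  define v where "v = (\<lambda>i. z i - (a * \<mu> i + c i))"
  define b where "b = a / (s + a\<^sup>2)"
  define t where "t = s / (s + a\<^sup>2)"
  have t: "t > 0" using s sa by (simp add: t_def)
  \<comment> \<open>Both sides are multiples of \<open>gauss_mass 1\<close> squared, and the factors
    agree because \<open>t * (s + a\<^sup>2) = s\<close>.\<close>
  have ZZ: "gauss_mass t * gauss_mass (s + a\<^sup>2) = gauss_mass 1 * gauss_mass s"
    using gauss_mass_scale[of 1 t] gauss_mass_scale[of 1 s] gauss_mass_scale[of 1 "s + a\<^sup>2"] s sa t
    by (simp add: t_def real_sqrt_divide power_divide)
  have square: "q (\<lambda>i. x i - \<mu> i) / 2 + q (\<lambda>i. z i - (a * x i + c i)) / (2 * s)
      = q (\<lambda>i. x i - (\<mu> i + b * v i)) / (2 * t) + q v / (2 * (s + a\<^sup>2))" for x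
  proof -
    define u where "u = (\<lambda>i. x i - \<mu> i)"
    have 1: "(\<lambda>i. z i - (a * x i + c i)) = (\<lambda>i. 1 * v i + (-a) * u i)"
      by (auto simp: v_def u_def algebra_simps)
    have 2: "(\<lambda>i. x i - (\<mu> i + b * v i)) = (\<lambda>i. 1 * u i + (-b) * v i)"
      by (auto simp: v_def u_def algebra_simps)
    show ?thesis
      unfolding 1 2 q_lin bilin_sym[of v u] u_def[symmetric] using s sa
      by (simp add: b_def t_def divide_simps) (simp add: algebra_simps power2_eq_square)
  qed
  have "ennreal (gauss_dens 1 \<mu> x) * ennreal (gauss_dens s (\<lambda>i. a * x i + c i) z)
      = ennreal (exp (- q v / (2 * (s + a\<^sup>2))) / (gauss_mass 1 * gauss_mass s))
        * ennreal (exp (- q (\<lambda>i. x i - (\<mu> i + b * v i)) / (2 * t)))" for x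
  proof -
    have "gauss_dens 1 \<mu> x * gauss_dens s (\<lambda>i. a * x i + c i) z
        = exp (- (q (\<lambda>i. x i - \<mu> i) / 2 + q (\<lambda>i. z i - (a * x i + c i)) / (2 * s))) / (gauss_mass 1 * gauss_mass s)"
      by (simp add: gauss_dens_def mult_exp_exp)
    also have "\<dots> = exp (- q v / (2 * (s + a\<^sup>2))) / (gauss_mass 1 * gauss_mass s)
        * exp (- q (\<lambda>i. x i - (\<mu> i + b * v i)) / (2 * t))"
      unfolding square by (simp add: exp_diff exp_minus field_simps)
    finally show ?thesis
      using s gauss_mass_pos[of 1] gauss_mass_pos[of s] by (simp add: gauss_dens_nonneg flip: ennreal_mult)
  qed
  then have "(\<integral>\<^sup>+x. ennreal (gauss_dens 1 \<mu> x) * ennreal (gauss_dens s (\<lambda>i. a * x i + c i) z) \<partial>euclid_lborel d)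
      = ennreal (exp (- q v / (2 * (s + a\<^sup>2))) / (gauss_mass 1 * gauss_mass s)) * ennreal (gauss_mass t)"
    by (simp add: nn_integral_cmult nn_integral_exp_q[OF t, simplified])
  also have "\<dots> = ennreal (exp (- q v / (2 * (s + a\<^sup>2))) / (gauss_mass 1 * gauss_mass s) * gauss_mass t)"
    using s t gauss_mass_pos[of 1] gauss_mass_pos[of s] gauss_mass_pos[of t] by (simp flip: ennreal_mult)
  also have "exp (- q v / (2 * (s + a\<^sup>2))) / (gauss_mass 1 * gauss_mass s) * gauss_mass t = gauss_dens (s + a\<^sup>2) (\<lambda>i. a * \<mu> i + c i) z"
    unfolding ZZ[symmetric] using gauss_mass_pos[OF t] by (simp add: gauss_dens_def v_def)
  finally show ?thesis .
qed

text \<open>Only the sigma-algebras of the factors are fixed, so that the lemma serves both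
  arbitrary datasets and products of Gaussians.\<close>

lemma measurable_data_coord:
  assumes "j < n" "i < d" "\<And>j. sets (M j) = sets (euclid_lborel d)"
  shows "(\<lambda>y. y j i) \<in> borel_measurable (PiM {..<n} M)"
proof -
  have "(\<lambda>y. y j) \<in> PiM {..<n} M \<rightarrow>\<^sub>M M j"
    using assms(1) by (intro measurable_component_singleton) simp
  then have "(\<lambda>y. y j) \<in> PiM {..<n} M \<rightarrow>\<^sub>M euclid_lborel d"
    using measurable_cong_sets[OF refl assms(3)] by blast
  from measurable_compose[OF this measurable_coord[OF assms(2)]] show ?thesis .
qed

text \<open>Integrating out the last sample adds \<open>a\<^sup>2\<close> to \<open>s\<close> and
  \<open>a * \<mu>\<close> to \<open>c\<close>; hence the induction generalizes over both.\<close>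

lemma gauss_dens_convolution_iterated:
  assumes "s > 0"
  shows "(\<integral>\<^sup>+y. ennreal (gauss_dens s (\<lambda>i. a * (\<Sum>j<k. y j i) + c i) z) \<partial>PiM {..<k} (\<lambda>_. gauss 1 \<mu>))
    = ennreal (gauss_dens (s + real k * a\<^sup>2) (\<lambda>i. real k * a * \<mu> i + c i) z)"
  using assms
proof (induction k arbitrary: s c)
  case 0
  show ?case by (simp add: PiM_empty nn_integral_count_space_finite)
next
  case (Suc k)
  interpret product_sigma_finite "\<lambda>_::nat. gauss 1 \<mu>"
    using prob_space_gauss[of 1 \<mu>] by (simp add: product_sigma_finite_def prob_space_imp_sigma_finite)
  have meas: "(\<lambda>y. gauss_dens s (\<lambda>i. a * (\<Sum>j<Suc k. y j i) + c i) z) \<in> borel_measurable (PiM {..<Suc k} (\<lambda>_. gauss 1 \<mu>))"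
    by (intro measurable_gauss_dens borel_measurable_add borel_measurable_times borel_measurable_const
        borel_measurable_sum measurable_data_coord) auto
  have "(\<integral>\<^sup>+y. ennreal (gauss_dens s (\<lambda>i. a * (\<Sum>j<Suc k. y j i) + c i) z) \<partial>PiM {..<Suc k} (\<lambda>_. gauss 1 \<mu>))
    = (\<integral>\<^sup>+y. (\<integral>\<^sup>+x. ennreal (gauss_dens s (\<lambda>i. a * (\<Sum>j<Suc k. (y(k := x)) j i) + c i) z) \<partial>gauss 1 \<mu>)
        \<partial>PiM {..<k} (\<lambda>_. gauss 1 \<mu>))"
    unfolding lessThan_Suc using meas[unfolded lessThan_Suc]
    by (intro product_nn_integral_insert) auto
  also have "\<dots> = (\<integral>\<^sup>+y. ennreal (gauss_dens (s + a\<^sup>2) (\<lambda>i. a * (\<Sum>j<k. y j i) + (a * \<mu> i + c i)) z)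
        \<partial>PiM {..<k} (\<lambda>_. gauss 1 \<mu>))"
  proof (intro nn_integral_cong)
    fix y :: "nat \<Rightarrow> nat \<Rightarrow> real"
    have *: "(\<lambda>i. a * (\<Sum>j<Suc k. (y(k := x)) j i) + c i)
        = (\<lambda>i. a * x i + (a * (\<Sum>j<k. y j i) + c i))" for x
      by (auto simp: algebra_simps)
    have [measurable]: "(\<lambda>x. gauss_dens s (\<lambda>i. a * x i + (a * (\<Sum>j<k. y j i) + c i)) z)
        \<in> borel_measurable (euclid_lborel d)"
      by (intro measurable_gauss_dens borel_measurable_add borel_measurable_times borel_measurable_const
          measurable_coord)
    show "(\<integral>\<^sup>+x. ennreal (gauss_dens s (\<lambda>i. a * (\<Sum>j<Suc k. (y(k := x)) j i) + c i) z) \<partial>gauss 1 \<mu>)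
        = ennreal (gauss_dens (s + a\<^sup>2) (\<lambda>i. a * (\<Sum>j<k. y j i) + (a * \<mu> i + c i)) z)"
      unfolding * unfolding gauss_def
      by (simp add: nn_integral_density gauss_dens_convolution[OF \<open>s > 0\<close>]) (simp add: algebra_simps)
  qed
  also have "\<dots> = ennreal (gauss_dens (s + real (Suc k) * a\<^sup>2) (\<lambda>i. real (Suc k) * a * \<mu> i + c i) z)"
    using \<open>s > 0\<close> by (subst Suc.IH) (simp_all add: add_pos_nonneg algebra_simps)
  finally show ?case .
qed

section \<open>Privacy and tail bounds for Gaussians\<close>

text \<open>The last term is \<open>f (f / (e\<^sup>\<epsilon> h))\<^sup>l\<close> for the densities \<open>f\<close> and \<open>h\<close> of the two Gaussians; it is
  at least \<open>f\<close> wherever \<open>f > e\<^sup>\<epsilon> h\<close>.\<close>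

lemma gauss_dens_le_shifted:
  assumes s: "s > 0" and l: "l \<ge> 0"
  shows "gauss_dens s m x \<le> exp \<epsilon> * gauss_dens s m' x
    + exp (l * (l + 1) * q (\<lambda>i. m i - m' i) / (2 * s) - l * \<epsilon>) * gauss_dens s (\<lambda>i. m i + l * (m i - m' i)) x"
proof -
  define u where "u = (\<lambda>i. x i - m i)"
  define w where "w = (\<lambda>i. m i - m' i)"
  \<comment> \<open>\<open>L\<close> is the privacy loss at \<open>x\<close>: the logarithm of the
    ratio of the densities with means \<open>m\<close> and \<open>m'\<close>.\<close>
  define L where "L = (2 * bilin u w + q w) / (2 * s)"
  have 1: "(\<lambda>i. x i - m' i) = (\<lambda>i. 1 * u i + 1 * w i)"
    and 2: "(\<lambda>i. x i - (m i + l * (m i - m' i))) = (\<lambda>i. 1 * u i + (-l) * w i)"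
    by (auto simp: u_def w_def)
  have h: "exp \<epsilon> * gauss_dens s m' x = exp (\<epsilon> - L) * gauss_dens s m x"
    unfolding gauss_dens_def 1 q_lin u_def[symmetric] using s
    by (simp add: mult_exp_exp L_def add_divide_distrib diff_divide_distrib)
  have T: "exp (l * (l + 1) * q w / (2 * s) - l * \<epsilon>) * gauss_dens s (\<lambda>i. m i + l * (m i - m' i)) x
      = exp (l * (L - \<epsilon>)) * gauss_dens s m x"
  proof -
    have "l * (l + 1) * q w / (2 * s) - l * \<epsilon> - q (\<lambda>i. 1 * u i + (-l) * w i) / (2 * s)
        = l * (L - \<epsilon>) - q u / (2 * s)"
      unfolding q_lin L_def using s by (simp add: divide_simps) (simp add: algebra_simps power2_eq_square)
    then show ?thesis
      unfolding gauss_dens_def 2 u_def[symmetric] by (simp add: mult_exp_exp)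
  qed
  show ?thesis
  proof (cases "L \<le> \<epsilon>")
    case True
    then have "1 * gauss_dens s m x \<le> exp (\<epsilon> - L) * gauss_dens s m x"
      using gauss_dens_nonneg[OF s] by (intro mult_right_mono) auto
    then show ?thesis
      unfolding h[symmetric] using gauss_dens_nonneg[OF s] by (simp add: add_increasing2)
  next
    case False
    then have "1 * gauss_dens s m x \<le> exp (l * (L - \<epsilon>)) * gauss_dens s m x"
      using gauss_dens_nonneg[OF s] l by (intro mult_right_mono) auto
    then show ?thesis
      unfolding T[symmetric] using gauss_dens_nonneg[OF s] by (simp add: add_increasing w_def)
  qed
qed

text \<open>The pointwise bound is integrated over \<open>S\<close>. The third Gaussian has total
  mass 1, so its coefficient alone bounds the additive error. The exponent \<open>l\<close> stays
  free, to be chosen in terms of \<epsilon> and \<delta>.\<close>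

lemma gaussian_mechanism_private:
  assumes s: "s > 0" and l: "l \<ge> 0" and S: "S \<in> sets (euclid_lborel d)"
    and \<delta>: "exp (l * (l + 1) * q (\<lambda>i. m i - m' i) / (2 * s) - l * \<epsilon>) \<le> \<delta>"
  shows "measure (gauss s m) S \<le> exp \<epsilon> * measure (gauss s m') S + \<delta>"
proof -
  interpret m: prob_space "gauss s m" by (rule prob_space_gauss[OF s])
  interpret m': prob_space "gauss s m'" by (rule prob_space_gauss[OF s])
  let ?m = "\<lambda>i. m i + l * (m i - m' i)"
  interpret m'': prob_space "gauss s ?m" by (rule prob_space_gauss[OF s])
  have \<delta>0: "0 \<le> \<delta>" using \<delta> by (rule order_trans[rotated]) simp
  have "emeasure (gauss s m) S \<le> (\<integral>\<^sup>+x. ennreal (exp \<epsilon>) * (ennreal (gauss_dens s m' x) * indicator S x)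
      + ennreal \<delta> * (ennreal (gauss_dens s ?m x) * indicator S x) \<partial>euclid_lborel d)"
    unfolding emeasure_gauss[OF S]
  proof (rule nn_integral_mono)
    fix x
    have "gauss_dens s m x \<le> exp \<epsilon> * gauss_dens s m' x + \<delta> * gauss_dens s ?m x"
      using gauss_dens_le_shifted[OF s l, of m x \<epsilon> m'] mult_right_mono[OF \<delta> gauss_dens_nonneg[OF s, of ?m x]] by linarith
    then show "ennreal (gauss_dens s m x) * indicator S x \<le> ennreal (exp \<epsilon>) * (ennreal (gauss_dens s m' x) * indicator S x)
      + ennreal \<delta> * (ennreal (gauss_dens s ?m x) * indicator S x)"
      using gauss_dens_nonneg[OF s] \<delta>0
      by (auto split: split_indicator simp flip: ennreal_mult ennreal_plus intro!: ennreal_leI)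
  qed
  also have "\<dots> = ennreal (exp \<epsilon>) * emeasure (gauss s m') S + ennreal \<delta> * emeasure (gauss s ?m) S"
    using S by (simp add: nn_integral_add nn_integral_cmult emeasure_gauss)
  also have "\<dots> = ennreal (exp \<epsilon> * measure (gauss s m') S + \<delta> * measure (gauss s ?m) S)"
    using \<delta>0 by (simp add: m'.emeasure_eq_measure m''.emeasure_eq_measure flip: ennreal_mult ennreal_plus)
  finally have "measure (gauss s m) S \<le> exp \<epsilon> * measure (gauss s m') S + \<delta> * measure (gauss s ?m) S"
    using \<delta>0 by (simp add: m.emeasure_eq_measure flip: ennreal_plus)
  also have "\<delta> * measure (gauss s ?m) S \<le> \<delta>"
    using \<delta>0 by (simp add: mult_left_le)
  finally show ?thesis by simp
qed

text \<open>A Chernoff bound by comparison with covariance 2 \<Sigma>: half of the exponent is at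
  most \<open>- t / 4\<close> on the tail, the other half is the exponent of the wider Gaussian, and
  the masses differ by the factor \<open>sqrt 2 ^ d\<close>.\<close>

lemma gaussian_tail:
  "measure (gauss 1 \<mu>) {x \<in> space (euclid_lborel d). t < q (\<lambda>i. x i - \<mu> i)} \<le> sqrt 2 ^ d * exp (- t / 4)"
    (is "measure _ ?S \<le> ?c")
proof -
  interpret prob_space "gauss 1 \<mu>" by (rule prob_space_gauss) simp
  have Z2: "gauss_mass 2 = sqrt 2 ^ d * gauss_mass 1" using gauss_mass_scale[of 1 2] by simp
  have S[measurable]: "?S \<in> sets (euclid_lborel d)" by measurable
  have "emeasure (gauss 1 \<mu>) ?S \<le> (\<integral>\<^sup>+x. ennreal ?c * ennreal (gauss_dens 2 \<mu> x) \<partial>euclid_lborel d)"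
    unfolding emeasure_gauss[OF S]
  proof (rule nn_integral_mono)
    fix x
    show "ennreal (gauss_dens 1 \<mu> x) * indicator ?S x \<le> ennreal ?c * ennreal (gauss_dens 2 \<mu> x)"
    proof (cases "x \<in> ?S")
      case True
      then have "exp (- q (\<lambda>i. x i - \<mu> i) / 2) \<le> exp (- t / 4) * exp (- q (\<lambda>i. x i - \<mu> i) / 4)"
        by (simp add: mult_exp_exp)
      then have "gauss_dens 1 \<mu> x \<le> ?c * gauss_dens 2 \<mu> x"
        using gauss_mass_pos[of 1] by (simp add: gauss_dens_def Z2 divide_right_mono)
      then show ?thesis
        using True by (simp add: gauss_dens_nonneg ennreal_leI flip: ennreal_mult)
    qed simp
  qed
  also have "\<dots> = ennreal ?c"
    by (simp add: nn_integral_cmult nn_integral_gauss_dens)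
  finally show ?thesis by (simp add: emeasure_eq_measure)
qed

end

section \<open>The truncated logistic function\<close>

definition logistic :: "real \<Rightarrow> real" where
  "logistic x = 1 / (1 + exp (- x))"

lemma logistic_pos: "0 < logistic x"
  by (simp add: logistic_def add_pos_pos)

lemma logistic_minus: "1 - logistic x = logistic (- x)"
  using exp_gt_zero[of x] exp_gt_zero[of "-x"]
  by (simp add: logistic_def exp_minus field_simps del: exp_gt_zero)

lemma logistic_le_exp: "logistic x \<le> exp x"
proof -
  have "1 \<le> exp x * (1 + exp (- x))"
    by (simp add: distrib_left mult_exp_exp)
  then show ?thesis
    by (simp add: logistic_def pos_divide_le_eq add_pos_pos)
qed

text \<open>The logarithm of \<open>logistic\<close> is 1-Lipschitz. By the symmetry
  \<open>logistic_minus\<close> this controls both outcomes of a logistic coin.\<close>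

lemma logistic_ratio:
  assumes "\<bar>x - y\<bar> \<le> t"
  shows "logistic x \<le> exp t * logistic y"
proof -
  have "exp (- y) \<le> exp t * exp (- x)"
    using assms by (simp add: mult_exp_exp)
  moreover have "1 \<le> exp t" using assms by simp
  ultimately have "1 + exp (- y) \<le> exp t * (1 + exp (- x))"
    unfolding distrib_left mult_1_right by (rule add_mono[rotated])
  then show ?thesis
    by (simp add: logistic_def field_simps add_pos_pos)
qed

text \<open>Subtracting \<eta> makes acceptance impossible, not merely unlikely, for very negative
  \<open>x\<close>. A positive acceptance probability thus certifies a lower bound on
  \<open>x\<close>.\<close>

definition accept :: "real \<Rightarrow> real \<Rightarrow> real" where
  "accept \<eta> x = max 0 (logistic x - \<eta>)"

lemma accept_nonneg: "0 \<le> accept \<eta> x"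
  by (simp add: accept_def)

lemma accept_le_logistic: "0 \<le> \<eta> \<Longrightarrow> accept \<eta> x \<le> logistic x"
  using logistic_pos[of x] by (simp add: accept_def)

lemma accept_le_1: "0 \<le> \<eta> \<Longrightarrow> accept \<eta> x \<le> 1"
  using accept_le_logistic[of \<eta> x] logistic_minus[of x] logistic_pos[of "-x"] by simp

text \<open>Since \<open>exp t \<le> 2\<close>, reinstating the truncation on the right costs at
  most \<open>2 * \<eta>\<close>, and the truncation on the left gives one \<eta> back.\<close>

lemma accept_ratio:
  assumes "\<bar>x - y\<bar> \<le> t" "exp t \<le> 2" "0 \<le> \<eta>"
  shows "accept \<eta> x \<le> exp t * accept \<eta> y + \<eta>"
proof -
  have "logistic x \<le> exp t * (logistic y - \<eta>) + 2 * \<eta>"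
    using logistic_ratio[OF assms(1)] mult_right_mono[OF assms(2,3)] by (simp add: algebra_simps)
  also have "\<dots> \<le> exp t * accept \<eta> y + 2 * \<eta>"
    by (simp add: accept_def)
  finally show ?thesis
    using accept_nonneg[of \<eta> y] assms(3) by (auto simp: accept_def[of \<eta> x])
qed

lemma reject_ratio:
  assumes "\<bar>x - y\<bar> \<le> t" "0 \<le> \<eta>"
  shows "1 - accept \<eta> x \<le> exp t * (1 - accept \<eta> y) + \<eta>"
proof -
  have "1 - accept \<eta> x \<le> logistic (- x) + \<eta>"
    using logistic_minus[of x] by (simp add: accept_def)
  also have "logistic (- x) \<le> exp t * logistic (- y)"
    using assms(1) by (intro logistic_ratio) simp
  also have "\<dots> \<le> exp t * (1 - accept \<eta> y)"
    using accept_le_logistic[OF assms(2), of y] by (simp flip: logistic_minus)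
  finally show ?thesis by simp
qed

lemma accept_pos_imp:
  assumes "0 < accept \<eta> x" "0 < \<eta>"
  shows "ln \<eta> < x"
proof -
  have "\<eta> < exp x"
    using assms logistic_le_exp[of x] by (simp add: accept_def)
  then show ?thesis
    using assms(2) by (metis exp_less_cancel_iff exp_ln)
qed

text \<open>One \<eta> pays for the logistic tail, the other for the truncation.\<close>

lemma accept_ge:
  assumes "- ln \<eta> \<le> x" "0 < \<eta>"
  shows "1 - 2 * \<eta> \<le> accept \<eta> x"
proof -
  have "logistic (- x) \<le> exp (ln \<eta>)"
    using assms logistic_le_exp[of "- x"] by (smt (verit) exp_le_cancel_iff)
  then show ?thesis
    using logistic_minus[of x] assms(2) by (simp add: accept_def)
qed

section \<open>The weighted mean and its sensitivity\<close>

context pd_form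
begin

definition degree :: "nat \<Rightarrow> real \<Rightarrow> (nat \<Rightarrow> nat \<Rightarrow> real) \<Rightarrow> nat \<Rightarrow> real" where
  "degree n r y j = (\<Sum>k<n. of_bool (qnorm (\<lambda>i. y j i - y k i) \<le> r))"

text \<open>A ramp from 0 at degree \<open>3 * n / 4\<close> to 1 at degree \<open>n\<close>,
  instead of a sharp cutoff: changing the degree by one moves the weight by at most
  \<open>4 / n\<close>.\<close>

definition weight :: "nat \<Rightarrow> real \<Rightarrow> (nat \<Rightarrow> nat \<Rightarrow> real) \<Rightarrow> nat \<Rightarrow> real" where
  "weight n r y j = max 0 (4 * degree n r y j / n - 3)"

definition total :: "nat \<Rightarrow> real \<Rightarrow> (nat \<Rightarrow> nat \<Rightarrow> real) \<Rightarrow> real" where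
  "total n r y = (\<Sum>j<n. weight n r y j)"

definition centre :: "nat \<Rightarrow> real \<Rightarrow> (nat \<Rightarrow> nat \<Rightarrow> real) \<Rightarrow> nat \<Rightarrow> real" where
  "centre n r y i = (\<Sum>j<n. weight n r y j * y j i) / total n r y"

lemma degree_eq_card: "degree n r y j = real (card {k \<in> {..<n}. qnorm (\<lambda>i. y j i - y k i) \<le> r})"
  by (simp add: degree_def Int_def)

lemma degree_le: "degree n r y j \<le> real n"
  unfolding degree_eq_card of_nat_le_iff
  by (rule order_trans[OF card_mono[of "{..<n}"]]) auto

lemma weight_nonneg: "0 \<le> weight n r y j"
  by (simp add: weight_def)

lemma weight_le_1: "weight n r y j \<le> 1"
  using degree_le[of n r y j] by (cases "n = 0") (auto simp: weight_def field_simps)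

lemma weight_pos_imp:
  assumes "0 < weight n r y j"
  shows "4 * degree n r y j > 3 * real n"
proof -
  have "0 < 4 * degree n r y j / n - 3"
    using assms by (simp add: weight_def)
  then show ?thesis
    by (cases "n = 0") (auto simp: field_simps)
qed

text \<open>Two neighborhoods of more than \<open>3 * n / 4\<close> indices share more than
  \<open>n / 2 \<ge> 1\<close>, hence at least two. One shared index avoids the modified position
  \<open>k\<close>, and there the datasets agree, so the triangle inequality passes through that
  sample.\<close>

lemma close_of_positive_weights:
  assumes n: "2 \<le> n" and eq: "\<And>j. j \<noteq> k \<Longrightarrow> y j = y' j"
    and a: "0 < weight n r y a" and b: "0 < weight n r y' b"
  shows "qnorm (\<lambda>i. y a i - y' b i) \<le> 2 * r"
proof -
  let ?S = "{l \<in> {..<n}. qnorm (\<lambda>i. y a i - y l i) \<le> r}"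
  let ?T = "{l \<in> {..<n}. qnorm (\<lambda>i. y' b i - y' l i) \<le> r}"
  have "4 * card ?S > 3 * n" "4 * card ?T > 3 * n"
    using weight_pos_imp[OF a] weight_pos_imp[OF b] unfolding degree_eq_card by linarith+
  moreover have "card ?S + card ?T = card (?S \<union> ?T) + card (?S \<inter> ?T)"
    by (rule card_Un_Int) auto
  moreover have "card (?S \<union> ?T) \<le> card {..<n}"
    by (rule card_mono) auto
  ultimately have "1 < card (?S \<inter> ?T)" using n by simp
  then have "\<not> ?S \<inter> ?T \<subseteq> {k}"
    using card_mono[of "{k}" "?S \<inter> ?T"] by auto
  then obtain l where "l \<noteq> k" "qnorm (\<lambda>i. y a i - y l i) \<le> r" "qnorm (\<lambda>i. y' b i - y' l i) \<le> r"
    by auto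
  then show ?thesis
    using qnorm_triangle'[of "y a" "y' b" "y l"] qnorm_minus[of "y' b" "y' l"] eq[of l] by simp
qed

context
  fixes n k :: nat and r :: real and y y' :: "nat \<Rightarrow> nat \<Rightarrow> real"
  assumes n: "2 \<le> n" and k: "k < n" and eq: "\<And>j. j \<noteq> k \<Longrightarrow> y j = y' j"
begin

text \<open>Away from \<open>k\<close>, only the summand for the changed sample can change in the
  degree.\<close>

lemma weight_sensitivity:
  assumes "j \<noteq> k"
  shows "\<bar>weight n r y j - weight n r y' j\<bar> \<le> 4 / n"
proof -
  have "degree n r z j = (\<Sum>l\<in>{..<n}-{k}. of_bool (qnorm (\<lambda>i. z j i - z l i) \<le> r))
      + of_bool (qnorm (\<lambda>i. z j i - z k i) \<le> r)" for z
    unfolding degree_def using k by (subst sum.remove[of _ k]) auto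
  moreover have "(\<Sum>l\<in>{..<n}-{k}. of_bool (qnorm (\<lambda>i. y j i - y l i) \<le> r) :: real)
      = (\<Sum>l\<in>{..<n}-{k}. of_bool (qnorm (\<lambda>i. y' j i - y' l i) \<le> r))"
    using eq assms by (intro sum.cong) auto
  ultimately have "\<bar>degree n r y j - degree n r y' j\<bar> \<le> 1" by auto
  then have "\<bar>(4 * degree n r y j / n - 3) - (4 * degree n r y' j / n - 3)\<bar> \<le> 4 / n"
    using n by (simp add: abs_le_iff field_simps)
  then show ?thesis by (auto simp: weight_def)
qed

lemma weight_sensitivity_sum: "(\<Sum>j\<in>{..<n}-{k}. \<bar>weight n r y j - weight n r y' j\<bar>) \<le> 4"
proof -
  have "(\<Sum>j\<in>{..<n}-{k}. \<bar>weight n r y j - weight n r y' j\<bar>) \<le> (\<Sum>j\<in>{..<n}-{k}. 4 / n)"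
    by (intro sum_mono weight_sensitivity) auto
  also have "\<dots> \<le> 4" using n k by (simp add: field_simps)
  finally show ?thesis .
qed

text \<open>The other weights contribute at most 4 together, and the weight of the changed sample,
  which lies in [0, 1], at most 1.\<close>

lemma total_sensitivity: "\<bar>total n r y - total n r y'\<bar> \<le> 5"
proof -
  have "\<bar>total n r y - total n r y'\<bar> \<le> (\<Sum>j<n. \<bar>weight n r y j - weight n r y' j\<bar>)"
    unfolding total_def sum_subtractf[symmetric] by (rule sum_abs)
  also have "\<dots> = \<bar>weight n r y k - weight n r y' k\<bar>
      + (\<Sum>j\<in>{..<n}-{k}. \<bar>weight n r y j - weight n r y' j\<bar>)"
    using k by (subst sum.remove[of _ k]) auto
  also have "\<bar>weight n r y k - weight n r y' k\<bar> \<le> 1"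
    using weight_nonneg[of n r y k] weight_nonneg[of n r y' k]
      weight_le_1[of n r y k] weight_le_1[of n r y' k] by linarith
  finally show ?thesis using weight_sensitivity_sum by linarith
qed

text \<open>All samples are measured from one anchor \<open>y' b\<close> of positive weight, so
  every vector that counts has norm at most \<open>2 * r\<close>. The constant is
  \<open>44 = 2 * (12 + 5 * 2)\<close>: 12 for the change of the weighted sum, \<open>5 * 2\<close>
  for the change of the total, and 2 from dividing by at least \<open>n / 2\<close>.\<close>

lemma centre_sensitivity:
  assumes r: "0 \<le> r" and W: "real n / 2 \<le> total n r y" and W': "real n / 2 \<le> total n r y'"
  shows "qnorm (\<lambda>i. centre n r y i - centre n r y' i) \<le> 44 * r / n"
proof -
  let ?w = "weight n r y" and ?w' = "weight n r y'"
  let ?W = "total n r y" and ?W' = "total n r y'"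
  have pos: "0 < ?W" "0 < ?W'" using n W W' by linarith+
  obtain b where b: "0 < ?w' b"
  proof -
    have "\<not> (\<forall>j<n. ?w' j \<le> 0)"
    proof
      assume "\<forall>j<n. ?w' j \<le> 0"
      then have "?W' \<le> 0" unfolding total_def by (intro sum_nonpos) auto
      then show False using pos by simp
    qed
    then show ?thesis using that by (auto simp: not_le)
  qed
  define u where "u = (\<lambda>j i. y j i - y' b i)"
  define u' where "u' = (\<lambda>j i. y' j i - y' b i)"
  have u: "qnorm (u j) \<le> 2 * r" if "0 < ?w j" for j
    unfolding u_def by (rule close_of_positive_weights[OF n eq that b])
  have u': "qnorm (u' j) \<le> 2 * r" if "0 < ?w' j" for j
    unfolding u'_def by (rule close_of_positive_weights[OF n refl that b])
  have wu: "?w j * qnorm (u j) \<le> ?w j * (2 * r)" for j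
    using u[of j] weight_nonneg[of n r y j] by (cases "?w j = 0") (auto intro!: mult_left_mono)
  have wu': "?w' j * qnorm (u' j) \<le> ?w' j * (2 * r)" for j
    using u'[of j] weight_nonneg[of n r y' j] by (cases "?w' j = 0") (auto intro!: mult_left_mono)
  define e where "e = (\<lambda>j i. ?w j * u j i - ?w' j * u' j i)"
  have e: "qnorm (e j) \<le> \<bar>?w j - ?w' j\<bar> * (2 * r)" if "j \<noteq> k" for j
  proof -
    have uu: "u' j = u j" using eq[OF that] by (simp add: u_def u'_def)
    have "e j = (\<lambda>i. (?w j - ?w' j) * u j i)"
      by (simp add: e_def uu left_diff_distrib)
    then have "qnorm (e j) = \<bar>?w j - ?w' j\<bar> * qnorm (u j)" by (simp add: qnorm_scale)
    \<comment> \<open>If the nonnegative weights differ, one of them is positive, and the sample is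
      close to the anchor. Otherwise the factor in front is zero.\<close>
    moreover have "qnorm (u j) \<le> 2 * r" if "?w j \<noteq> ?w' j"
      using that u[of j] u'[of j] weight_nonneg[of n r y j] weight_nonneg[of n r y' j]
      unfolding uu by linarith
    ultimately show ?thesis by (cases "?w j = ?w' j") (auto intro!: mult_left_mono)
  qed
  have ek: "qnorm (e k) \<le> 4 * r"
  proof -
    have "e k = (\<lambda>i. ?w k * u k i + (- ?w' k) * u' k i)" by (simp add: e_def)
    then have "qnorm (e k) \<le> ?w k * qnorm (u k) + ?w' k * qnorm (u' k)"
      using qnorm_triangle[of "\<lambda>i. ?w k * u k i" "\<lambda>i. (- ?w' k) * u' k i"]
        weight_nonneg[of n r y k] weight_nonneg[of n r y' k] by (simp only: qnorm_scale) simp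
    also have "\<dots> \<le> 2 * r + 2 * r"
      using wu[of k] wu'[of k] mult_right_mono[OF weight_le_1[of n r y k], of "2 * r"]
        mult_right_mono[OF weight_le_1[of n r y' k], of "2 * r"] r by linarith
    finally show ?thesis by simp
  qed
  \<comment> \<open>The changed sample contributes \<open>4 * r\<close>, and the weight changes of
    the others at most \<open>4 * (2 * r)\<close>.\<close>
  have E: "qnorm (\<lambda>i. \<Sum>j<n. e j i) \<le> 12 * r"
  proof -
    have "qnorm (\<lambda>i. \<Sum>j<n. e j i) \<le> (\<Sum>j<n. qnorm (e j))"
      using qnorm_sum[of "{..<n}" "\<lambda>_. 1" e] by simp
    also have "\<dots> = qnorm (e k) + (\<Sum>j\<in>{..<n}-{k}. qnorm (e j))"
      using k by (subst sum.remove[of _ k]) auto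
    also have "(\<Sum>j\<in>{..<n}-{k}. qnorm (e j)) \<le> (\<Sum>j\<in>{..<n}-{k}. \<bar>?w j - ?w' j\<bar> * (2 * r))"
      using e by (intro sum_mono) auto
    also have "\<dots> \<le> 4 * (2 * r)"
      unfolding sum_distrib_right[symmetric] using weight_sensitivity_sum r
      by (intro mult_right_mono) auto
    finally show ?thesis using ek by linarith
  qed
  have U: "qnorm (\<lambda>i. \<Sum>j<n. ?w' j * u' j i) \<le> ?W' * (2 * r)"
  proof -
    have "qnorm (\<lambda>i. \<Sum>j<n. ?w' j * u' j i) \<le> (\<Sum>j<n. \<bar>?w' j\<bar> * qnorm (u' j))"
      by (rule qnorm_sum) simp
    also have "\<dots> \<le> (\<Sum>j<n. ?w' j * (2 * r))"
      using wu' weight_nonneg[of n r y'] by (intro sum_mono) simp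
    finally show ?thesis by (simp add: total_def sum_distrib_right)
  qed
  have c: "(\<Sum>j<n. ?w j * u j i) = ?W * (centre n r y i - y' b i)" for i
  proof -
    have "(\<Sum>j<n. ?w j * u j i) = (\<Sum>j<n. ?w j * y j i) - ?W * y' b i"
      by (simp add: u_def total_def right_diff_distrib sum_subtractf sum_distrib_right)
    then show ?thesis
      using pos by (simp add: centre_def right_diff_distrib)
  qed
  have c': "(\<Sum>j<n. ?w' j * u' j i) = ?W' * (centre n r y' i - y' b i)" for i
  proof -
    have "(\<Sum>j<n. ?w' j * u' j i) = (\<Sum>j<n. ?w' j * y' j i) - ?W' * y' b i"
      by (simp add: u'_def total_def right_diff_distrib sum_subtractf sum_distrib_right)
    then show ?thesis
      using pos by (simp add: centre_def right_diff_distrib)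
  qed
  \<comment> \<open>The difference of two quotients is split into the change of the numerator over
    the first total, and the second numerator times the change of the reciprocal total.\<close>
  have "centre n r y i - centre n r y' i
      = (1 / ?W) * (\<Sum>j<n. e j i) + ((?W' - ?W) / (?W * ?W')) * (\<Sum>j<n. ?w' j * u' j i)" for i
    unfolding e_def sum_subtractf c c' using pos
    by (simp add: divide_simps) (simp add: algebra_simps)
  then have "qnorm (\<lambda>i. centre n r y i - centre n r y' i)
      \<le> \<bar>1 / ?W\<bar> * qnorm (\<lambda>i. \<Sum>j<n. e j i)
        + \<bar>(?W' - ?W) / (?W * ?W')\<bar> * qnorm (\<lambda>i. \<Sum>j<n. ?w' j * u' j i)"
    using qnorm_triangle[of "\<lambda>i. (1 / ?W) * (\<Sum>j<n. e j i)"
      "\<lambda>i. ((?W' - ?W) / (?W * ?W')) * (\<Sum>j<n. ?w' j * u' j i)"] by (simp only: qnorm_scale)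
  also have "\<dots> \<le> \<bar>1 / ?W\<bar> * (12 * r) + \<bar>(?W' - ?W) / (?W * ?W')\<bar> * (?W' * (2 * r))"
    using E U by (intro add_mono mult_left_mono) auto
  also have "\<dots> = (12 * r + \<bar>?W' - ?W\<bar> * (2 * r)) / ?W"
    using pos by (simp add: abs_divide abs_mult field_simps)
  also have "\<dots> \<le> (12 * r + 5 * (2 * r)) / ?W"
    using total_sensitivity pos r
    by (intro divide_right_mono add_left_mono mult_right_mono) (auto simp: abs_minus_commute)
  also have "\<dots> \<le> (12 * r + 5 * (2 * r)) / (real n / 2)"
    using W r n by (intro divide_left_mono) (auto intro!: mult_pos_pos pos)
  finally show ?thesis by simp
qed

end

section \<open>The noisy mean, and the mechanism as a Markov kernel\<close>

lemma sets_euclid: "sets (euclid d) = sets (euclid_lborel d)"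
  by (intro sets_PiM_cong) simp_all

lemma sigma_finite_euclid_lborel: "sigma_finite_measure (euclid_lborel d)"
proof -
  interpret finite_product_sigma_finite "\<lambda>_. lborel :: real measure" "{..<d}"
    by standard simp
  show ?thesis by unfold_locales
qed

lemma measurable_emeasure_gauss:
  assumes "\<And>i. i < d \<Longrightarrow> (\<lambda>w. m w i) \<in> borel_measurable M"
    and S[measurable]: "S \<in> sets (euclid_lborel d)"
  shows "(\<lambda>w. emeasure (gauss s (m w)) S) \<in> borel_measurable M"
proof -
  interpret sigma_finite_measure "euclid_lborel d" by (rule sigma_finite_euclid_lborel)
  have [measurable]: "(\<lambda>p. gauss_dens s (m (fst p)) (snd p)) \<in> borel_measurable (M \<Otimes>\<^sub>M euclid_lborel d)"
    by (intro measurable_gauss_dens measurable_compose[OF measurable_fst assms(1)]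
        measurable_compose[OF measurable_snd measurable_coord])
  show ?thesis
    unfolding emeasure_gauss[OF S] by (intro borel_measurable_nn_integral) measurable
qed

lemma measurable_measure_gauss:
  assumes "\<And>i. i < d \<Longrightarrow> (\<lambda>w. m w i) \<in> borel_measurable M"
    and "S \<in> sets (euclid_lborel d)"
  shows "(\<lambda>w. measure (gauss s (m w)) S) \<in> borel_measurable M"
  unfolding measure_def using measurable_emeasure_gauss[OF assms] by measurable

text \<open>The mean has covariance \<Sigma> / n and the noise (1 - 1 / n) \<Sigma>, which add up to
  \<Sigma>. On the ideal path the sampler therefore makes no error at all; \<open>n \<ge> 2\<close>
  keeps the noise nondegenerate.\<close>

lemma noisy_mean:
  assumes n: "2 \<le> n" and S[measurable]: "S \<in> sets (euclid_lborel d)"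
  shows "(\<integral>y. measure (gauss (1 - 1 / n) (\<lambda>i. (\<Sum>j<n. y j i) / real n)) S \<partial>PiM {..<n} (\<lambda>_. gauss 1 \<mu>))
    = measure (gauss 1 \<mu>) S"
proof -
  let ?D = "PiM {..<n} (\<lambda>_. gauss 1 \<mu>)" and ?s = "1 - 1 / real n"
  \<comment> \<open>The shape of \<open>gauss_dens_convolution_iterated\<close> with
    \<open>a = 1 / n\<close> and \<open>c = 0\<close>.\<close>
  let ?m = "\<lambda>y i. (1 / real n) * (\<Sum>j<n. y j i) + 0"
  have s: "0 < ?s" using n by simp
  interpret D: prob_space ?D by (intro prob_space_PiM prob_space_gauss) simp
  interpret E: sigma_finite_measure "euclid_lborel d" by (rule sigma_finite_euclid_lborel)
  interpret pair_sigma_finite ?D "euclid_lborel d" ..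
  have m: "(\<lambda>y. ?m y i) \<in> borel_measurable ?D" if "i < d" for i
    using that by (intro borel_measurable_add borel_measurable_times borel_measurable_const
        borel_measurable_sum measurable_data_coord) auto
  have gm: "(\<lambda>p. gauss_dens ?s (?m (fst p)) (snd p)) \<in> borel_measurable (?D \<Otimes>\<^sub>M euclid_lborel d)"
    by (intro measurable_gauss_dens measurable_compose[OF measurable_fst m]
        measurable_compose[OF measurable_snd measurable_coord])
  have gm1: "(\<lambda>y. gauss_dens ?s (?m y) x) \<in> borel_measurable ?D" for x
    by (intro measurable_gauss_dens m borel_measurable_const)
  have "(\<integral>\<^sup>+y. emeasure (gauss ?s (?m y)) S \<partial>?D)
      = (\<integral>\<^sup>+x. (\<integral>\<^sup>+y. ennreal (gauss_dens ?s (?m y) x) * indicator S x \<partial>?D) \<partial>euclid_lborel d)"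
    unfolding emeasure_gauss[OF S] using gm
    by (intro Fubini'[symmetric]) (simp add: case_prod_beta')
  also have "\<dots> = (\<integral>\<^sup>+x. ennreal (gauss_dens 1 \<mu> x) * indicator S x \<partial>euclid_lborel d)"
  proof (intro nn_integral_cong)
    fix x
    have "(\<integral>\<^sup>+y. ennreal (gauss_dens ?s (?m y) x) * indicator S x \<partial>?D)
        = (\<integral>\<^sup>+y. ennreal (gauss_dens ?s (?m y) x) \<partial>?D) * indicator S x"
      using gm1[of x] by (intro nn_integral_multc) simp
    also have "(\<integral>\<^sup>+y. ennreal (gauss_dens ?s (?m y) x) \<partial>?D)
        = ennreal (gauss_dens (?s + real n * (1 / n)\<^sup>2) (\<lambda>i. real n * (1 / n) * \<mu> i + 0) x)"
      by (rule gauss_dens_convolution_iterated[OF s])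
    also have "\<dots> = ennreal (gauss_dens 1 \<mu> x)"
      using n by (simp add: power2_eq_square)
    finally show "(\<integral>\<^sup>+y. ennreal (gauss_dens ?s (?m y) x) * indicator S x \<partial>?D)
        = ennreal (gauss_dens 1 \<mu> x) * indicator S x" .
  qed
  also have "\<dots> = emeasure (gauss 1 \<mu>) S" by (simp add: emeasure_gauss)
  also have "(\<integral>\<^sup>+y. emeasure (gauss ?s (?m y)) S \<partial>?D)
      = (\<integral>\<^sup>+y. ennreal (measure (gauss ?s (?m y)) S) \<partial>?D)"
    using prob_space_gauss[OF s]
    by (intro nn_integral_cong) (simp add: finite_measure.emeasure_eq_measure prob_space_def)
  also have "\<dots> = ennreal (\<integral>y. measure (gauss ?s (?m y)) S \<partial>?D)"
  proof (intro nn_integral_eq_integral D.integrable_const_bound[where B=1])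
    show "(\<lambda>y. measure (gauss ?s (?m y)) S) \<in> borel_measurable ?D"
      by (intro measurable_measure_gauss m S)
  qed (use prob_space.prob_le_1[OF prob_space_gauss[OF s]] in auto)
  finally show ?thesis
    using prob_space_gauss[of 1 \<mu>]
    by (simp add: finite_measure.emeasure_eq_measure prob_space_def integral_nonneg_AE)
qed

text \<open>The coin is absorbed into a single density, so the measure of a set is affine in
  \<open>p\<close>. The fallback Gaussian is centred at 0 and does not depend on the data.\<close>

definition mixture :: "real \<Rightarrow> real \<Rightarrow> (nat \<Rightarrow> real) \<Rightarrow> (nat \<Rightarrow> real) measure" where
  "mixture p s m = density (euclid_lborel d)
     (\<lambda>x. ennreal p * ennreal (gauss_dens s m x) + ennreal (1 - p) * ennreal (gauss_dens s (\<lambda>_. 0) x))"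

lemma sets_mixture [simp]: "sets (mixture p s m) = sets (euclid_lborel d)"
  by (simp add: mixture_def)

lemma emeasure_mixture:
  assumes "S \<in> sets (euclid_lborel d)"
  shows "emeasure (mixture p s m) S
    = ennreal p * emeasure (gauss s m) S + ennreal (1 - p) * emeasure (gauss s (\<lambda>_. 0)) S"
  using assms unfolding mixture_def
  by (simp add: emeasure_density emeasure_gauss distrib_right mult.assoc nn_integral_add nn_integral_cmult)

context
  fixes p s :: real and m :: "nat \<Rightarrow> real"
  assumes p: "0 \<le> p" "p \<le> 1" and s: "0 < s"
begin

interpretation G: prob_space "gauss s m'" for m'
  by (rule prob_space_gauss[OF s])

lemma prob_space_mixture: "prob_space (mixture p s m)"
proof
  have "emeasure (mixture p s m) (space (euclid_lborel d)) = ennreal p + ennreal (1 - p)"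
    using G.emeasure_space_1 by (subst emeasure_mixture) simp_all
  then show "emeasure (mixture p s m) (space (mixture p s m)) = 1"
    using p by (simp add: mixture_def flip: ennreal_plus)
qed

lemma measure_mixture:
  assumes "S \<in> sets (euclid_lborel d)"
  shows "measure (mixture p s m) S = p * measure (gauss s m) S + (1 - p) * measure (gauss s (\<lambda>_. 0)) S"
proof -
  have "emeasure (mixture p s m) S
      = ennreal (p * measure (gauss s m) S + (1 - p) * measure (gauss s (\<lambda>_. 0)) S)"
    using p by (simp add: emeasure_mixture[OF assms] G.emeasure_eq_measure flip: ennreal_mult ennreal_plus)
  then show ?thesis
    using p by (simp add: measure_def[of "mixture p s m"] del: ennreal_plus)
qed

end

text \<open>The threshold \<open>3 / 4 * n\<close> is midway between \<open>n / 2\<close>, needed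
  for \<open>centre_sensitivity\<close>, and \<open>n\<close>, reached on concentrated data. As the
  total has sensitivity 5, the factor \<open>\<epsilon> / 10\<close> lets the argument of
  \<open>accept\<close> move by at most \<open>\<epsilon> / 2\<close>.\<close>

definition mechanism ::
    "nat \<Rightarrow> real \<Rightarrow> real \<Rightarrow> real \<Rightarrow> (nat \<Rightarrow> nat \<Rightarrow> real) \<Rightarrow> (nat \<Rightarrow> real) measure" where
  "mechanism n r \<epsilon> \<eta> y =
     mixture (accept \<eta> (\<epsilon> * (total n r y - 3 / 4 * n) / 10)) (1 - 1 / n) (centre n r y)"

lemma measurable_weight:
  assumes "j < n" "\<And>j. sets (M j) = sets (euclid_lborel d)"
  shows "(\<lambda>y. weight n r y j) \<in> borel_measurable (PiM {..<n} M)"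
proof -
  have "(\<lambda>y. of_bool (qnorm (\<lambda>i. y j i - y k i) \<le> r) :: real) \<in> borel_measurable (PiM {..<n} M)" if "k < n" for k
  proof -
    have [measurable]: "(\<lambda>y. q (\<lambda>i. y j i - y k i)) \<in> borel_measurable (PiM {..<n} M)"
      by (intro measurable_bilin borel_measurable_diff measurable_data_coord assms that)
    show ?thesis unfolding qnorm_def of_bool_def by measurable
  qed
  then have [measurable]: "(\<lambda>y. degree n r y j) \<in> borel_measurable (PiM {..<n} M)"
    unfolding degree_def by (intro borel_measurable_sum) auto
  show ?thesis unfolding weight_def by measurable
qed

lemma measurable_total:
  assumes "\<And>j. sets (M j) = sets (euclid_lborel d)"
  shows "total n r \<in> borel_measurable (PiM {..<n} M)"
  unfolding total_def using assms by (intro borel_measurable_sum measurable_weight) auto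

lemma measurable_centre:
  assumes "\<And>j. sets (M j) = sets (euclid_lborel d)" "i < d"
  shows "(\<lambda>y. centre n r y i) \<in> borel_measurable (PiM {..<n} M)"
  unfolding centre_def using assms
  by (intro borel_measurable_divide borel_measurable_sum borel_measurable_times measurable_weight
      measurable_total measurable_data_coord) auto

lemma measurable_mechanism:
  assumes M: "\<And>j. sets (M j) = sets (euclid_lborel d)" and n: "2 \<le> n" and \<eta>: "0 \<le> \<eta>"
  shows "mechanism n r \<epsilon> \<eta> \<in> PiM {..<n} M \<rightarrow>\<^sub>M prob_algebra (euclid d)"
proof (rule measurable_prob_algebraI)
  have s: "0 < 1 - 1 / real n" using n by simp
  show prob: "prob_space (mechanism n r \<epsilon> \<eta> y)" for y
    unfolding mechanism_def using \<eta> s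
    by (intro prob_space_mixture) (auto simp: accept_nonneg accept_le_1)
  have t[measurable]: "(\<lambda>y. accept \<eta> (\<epsilon> * (total n r y - 3 / 4 * n) / 10)) \<in> borel_measurable (PiM {..<n} M)"
    using measurable_total[OF M] unfolding accept_def logistic_def by measurable
  show "mechanism n r \<epsilon> \<eta> \<in> PiM {..<n} M \<rightarrow>\<^sub>M subprob_algebra (euclid d)"
  proof (rule measurable_subprob_algebra)
    fix S assume "S \<in> sets (euclid d)"
    then have S: "S \<in> sets (euclid_lborel d)" by (simp add: sets_euclid)
    note [measurable] = measurable_emeasure_gauss[OF measurable_centre[OF M] S]
    show "(\<lambda>y. emeasure (mechanism n r \<epsilon> \<eta> y) S) \<in> borel_measurable (PiM {..<n} M)"
      unfolding mechanism_def emeasure_mixture[OF S] by measurable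
  qed (use prob in \<open>auto simp: mechanism_def sets_euclid intro: prob_space_imp_subprob_space\<close>)
qed

section \<open>Privacy of the mechanism\<close>

text \<open>The coin and the Gaussian noise each spend \<open>\<epsilon> / 2\<close>. The rejected
  branch uses \<open>\<delta> / 4\<close> of the additive budget and the accepted branch the
  remaining \<open>3 * \<delta> / 4\<close>.\<close>

lemma mechanism_private:
  assumes n: "2 \<le> n" and r: "0 \<le> r" and \<epsilon>: "0 < \<epsilon>" "\<epsilon> \<le> 1" and \<eta>: "0 < \<eta>" "\<eta> \<le> \<delta> / 4"
    and threshold: "- 40 * ln \<eta> \<le> \<epsilon> * n"
    and l: "0 \<le> l" "exp (l * (l + 1) * (44 * r / n)\<^sup>2 - l * (\<epsilon> / 2)) \<le> \<delta> / 4"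
  shows "differentially_private (euclid d) n (euclid d) \<epsilon> \<delta> (mechanism n r \<epsilon> \<eta>)"
  unfolding differentially_private_def
proof (intro allI impI ballI)
  fix y y' S
  assume nb: "neighbors (euclid d) n y y'" and "S \<in> sets (euclid d)"
  then have S: "S \<in> sets (euclid_lborel d)" by (simp add: sets_euclid)
  define s where "s = 1 - 1 / real n"
  have s: "0 < s" "1 \<le> 2 * s" using n by (auto simp: s_def field_simps)
  have sp: "y \<in> space (datasets (euclid d) n)" "y' \<in> space (datasets (euclid d) n)"
    and "card {i \<in> {..<n}. y i \<noteq> y' i} = 1"
    using nb by (auto simp: neighbors_def)
  then obtain k where k: "{i \<in> {..<n}. y i \<noteq> y' i} = {k}"
    by (auto simp: card_1_singleton_iff)
  then have kn: "k < n" by auto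
  \<comment> \<open>From index \<open>n\<close> on both datasets are \<open>undefined\<close>, so
    they agree everywhere except at \<open>k\<close>.\<close>
  have eq: "y j = y' j" if "j \<noteq> k" for j
  proof (cases "j < n")
    case True
    then show ?thesis using k that by auto
  next
    case False
    then show ?thesis using sp by (auto simp: space_PiM PiE_iff extensional_def)
  qed
  define x where "x z = \<epsilon> * (total n r z - 3 / 4 * n) / 10" for z
  define p where "p z = accept \<eta> (x z)" for z
  define a where "a z = measure (gauss s (centre n r z)) S" for z
  define b where "b = measure (gauss s (\<lambda>_. 0)) S"
  interpret G: prob_space "gauss s m" for m by (rule prob_space_gauss[OF s(1)])
  have p01: "0 \<le> p z" "p z \<le> 1" for z
    using \<eta> by (auto simp: p_def accept_nonneg accept_le_1)
  have a01: "0 \<le> a z" "a z \<le> 1" for z by (simp_all add: a_def)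
  have b01: "0 \<le> b" "b \<le> 1" by (simp_all add: b_def)
  have mech: "measure (mechanism n r \<epsilon> \<eta> z) S = p z * a z + (1 - p z) * b" for z
    unfolding mechanism_def s_def[symmetric] x_def[symmetric] p_def[symmetric]
    using p01[of z] s(1) S by (simp add: measure_mixture a_def b_def)
  have \<delta>: "0 < \<delta>" using \<eta> by simp
  have e2: "exp (\<epsilon> / 2) \<le> 2"
    using exp_bound[of "\<epsilon> / 2"] \<epsilon> power_mono[of "\<epsilon>/2" "1/2" 2] by (simp add: power2_eq_square)
  have e1: "1 \<le> exp (\<epsilon> / 2)" using \<epsilon> by simp
  have ee: "exp \<epsilon> = exp (\<epsilon> / 2) * exp (\<epsilon> / 2)" by (simp add: mult_exp_exp)
  have close: "\<bar>x y - x y'\<bar> \<le> \<epsilon> / 2"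
  proof -
    have "x y - x y' = \<epsilon> / 10 * (total n r y - total n r y')"
      by (simp add: x_def field_simps)
    from this[THEN arg_cong[where f=abs]] have "\<bar>x y - x y'\<bar> = \<epsilon> / 10 * \<bar>total n r y - total n r y'\<bar>"
      unfolding abs_mult using \<epsilon> by simp
    also have "\<dots> \<le> \<epsilon> / 10 * 5"
      using total_sensitivity[OF n kn eq] \<epsilon> by (intro mult_left_mono) auto
    finally show ?thesis by simp
  qed
  have acc: "p y \<le> exp (\<epsilon> / 2) * p y' + \<delta> / 4"
    using accept_ratio[OF close e2, of \<eta>] \<eta> by (simp add: p_def)
  have rej: "1 - p y \<le> exp (\<epsilon> / 2) * (1 - p y') + \<delta> / 4"
    using reject_ratio[OF close, of \<eta>] \<eta> by (simp add: p_def)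
  have rejected: "(1 - p y) * b \<le> exp \<epsilon> * ((1 - p y') * b) + \<delta> / 4"
  proof -
    have "(1 - p y) * b \<le> (exp (\<epsilon> / 2) * (1 - p y') + \<delta> / 4) * b"
      using rej b01(1) by (rule mult_right_mono)
    also have "\<dots> = exp (\<epsilon> / 2) * ((1 - p y') * b) + \<delta> / 4 * b"
      by (simp add: algebra_simps)
    also have "\<dots> \<le> exp \<epsilon> * ((1 - p y') * b) + \<delta> / 4"
      using b01 p01[of y'] \<delta> \<epsilon> by (intro add_mono mult_right_mono mult_left_le) auto
    finally show ?thesis .
  qed
  have accepted: "p y * a y \<le> exp \<epsilon> * (p y' * a y') + 3 * \<delta> / 4"
  proof (cases "0 < p y \<and> 0 < p y'")
    case False
    then have "p y \<le> \<delta> / 4"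
      \<comment> \<open>If one acceptance probability is zero, \<open>acc\<close> leaves at most the
        additive term for the other.\<close>
      using acc p01[of y] p01[of y'] \<delta> by (cases "p y' = 0") auto
    then have "p y * a y \<le> \<delta> / 4"
      using a01[of y] p01[of y] mult_left_le[of "a y" "p y"] by linarith
    moreover have "0 \<le> exp \<epsilon> * (p y' * a y')" using p01 a01 by simp
    ultimately show ?thesis using \<delta> by linarith
  next
    case True
    \<comment> \<open>Acceptance is possible only if \<open>x z\<close> exceeds
      \<open>ln \<eta> \<ge> - \<epsilon> * n / 40\<close>, which forces the total above
      \<open>n / 2\<close>.\<close>
    have half: "real n / 2 \<le> total n r z" if "0 < p z" for z
    proof -
      have "ln \<eta> < x z" using accept_pos_imp that \<eta> by (simp add: p_def)
      then have "- (\<epsilon> * n) < 4 * \<epsilon> * (total n r z - 3 / 4 * n)"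
        using threshold by (simp add: x_def)
      then have "0 < \<epsilon> * (total n r z - real n / 2)" by (simp add: algebra_simps)
      then show ?thesis using \<epsilon> by (simp add: zero_less_mult_iff)
    qed
    have "qnorm (\<lambda>i. centre n r y i - centre n r y' i) \<le> 44 * r / n"
      using True by (intro centre_sensitivity[OF n kn eq r] half) auto
    then have qle: "q (\<lambda>i. centre n r y i - centre n r y' i) \<le> (44 * r / n)\<^sup>2"
      unfolding qnorm_square[symmetric] using qnorm_nonneg by (intro power_mono) auto
    have "a y \<le> exp (\<epsilon> / 2) * a y' + \<delta> / 4"
      unfolding a_def
    proof (rule gaussian_mechanism_private[OF s(1) l(1) S])
      have "l * (l + 1) * q (\<lambda>i. centre n r y i - centre n r y' i) / (2 * s)
          \<le> l * (l + 1) * (44 * r / n)\<^sup>2 / 1"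
        using qle l(1) s q_nonneg by (intro frac_le mult_left_mono mult_nonneg_nonneg) auto
      then show "exp (l * (l + 1) * q (\<lambda>i. centre n r y i - centre n r y' i) / (2 * s) - l * (\<epsilon> / 2))
          \<le> \<delta> / 4"
        using l(2) by (intro order_trans[OF _ l(2)]) simp
    qed
    then have "p y * a y \<le> p y * (exp (\<epsilon> / 2) * a y' + \<delta> / 4)"
      using p01 by (intro mult_left_mono)
    also have "\<dots> \<le> p y * (exp (\<epsilon> / 2) * a y') + \<delta> / 4"
      using p01[of y] \<delta> by (simp add: distrib_left mult_left_le_one_le)
    also have "p y * (exp (\<epsilon> / 2) * a y') \<le> (exp (\<epsilon> / 2) * p y' + \<delta> / 4) * (exp (\<epsilon> / 2) * a y')"
      using acc a01 by (intro mult_right_mono) auto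
    also have "\<dots> = exp \<epsilon> * (p y' * a y') + \<delta> / 4 * (exp (\<epsilon> / 2) * a y')"
      unfolding ee by (simp add: algebra_simps)
    \<comment> \<open>The additive error of the coin is multiplied by
      \<open>exp (\<epsilon> / 2) \<le> 2\<close>; with the \<open>\<delta> / 4\<close> of the noise
      this makes \<open>3 * \<delta> / 4\<close>.\<close>
    also have "\<delta> / 4 * (exp (\<epsilon> / 2) * a y') \<le> \<delta> / 4 * (2 * 1)"
      using e2 a01 \<delta> by (intro mult_left_mono mult_mono) auto
    finally show ?thesis by simp
  qed
  show "measure (mechanism n r \<epsilon> \<eta> y) S \<le> exp \<epsilon> * measure (mechanism n r \<epsilon> \<eta> y') S + \<delta>"
    using rejected accepted unfolding mech by (simp add: distrib_left)
qed

section \<open>Accuracy of the mechanism\<close>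

text \<open>Samples within \<open>r / 2\<close> of \<mu> are pairwise within \<open>r\<close>, so
  all degrees are \<open>n\<close> and all weights 1.\<close>

lemma concentrated_dataset:
  assumes n: "2 \<le> n" and r: "0 \<le> r" and c: "\<forall>j<n. q (\<lambda>i. y j i - \<mu> i) \<le> r\<^sup>2 / 4"
  shows "total n r y = n" "centre n r y = (\<lambda>i. (\<Sum>j<n. y j i) / real n)"
proof -
  have half: "qnorm (\<lambda>i. y j i - \<mu> i) \<le> r / 2" if "j < n" for j
    using c[rule_format, OF that] r
    by (rule_tac power2_le_imp_le) (auto simp: qnorm_square power_divide)
  have "qnorm (\<lambda>i. y j i - y k i) \<le> r" if "j < n" "k < n" for j k
    using qnorm_triangle'[of "y j" "y k" \<mu>] half[OF that(1)] half[OF that(2)] qnorm_minus[of "y k" \<mu>] by simp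
  then have w: "weight n r y j = 1" if "j < n" for j
    using that n by (simp add: weight_def degree_def)
  show t: "total n r y = n" by (simp add: total_def w)
  show "centre n r y = (\<lambda>i. (\<Sum>j<n. y j i) / real n)"
    by (rule ext) (simp add: centre_def t w)
qed

text \<open>The mechanism is compared with the ideal one that always releases the noisy plain mean,
  which is exact by \<open>noisy_mean\<close>. They differ by at most 1 on the bad event that some
  sample is far from \<mu>, and by at most \<open>2 * \<eta>\<close>, the rejection probability,
  elsewhere.\<close>

lemma mechanism_accurate:
  assumes n: "2 \<le> n" and r: "0 \<le> r" and \<eta>: "0 < \<eta>"
    and threshold: "- 40 * ln \<eta> \<le> \<epsilon> * n"
    and \<alpha>: "real n * (sqrt 2 ^ d * exp (- r\<^sup>2 / 16)) + 2 * \<eta> \<le> \<alpha>"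
  shows "tv_dist (gauss 1 \<mu>) (output_dist n (mechanism n r \<epsilon> \<eta>) (gauss 1 \<mu>)) \<le> \<alpha>"
proof -
  let ?D = "PiM {..<n} (\<lambda>_. gauss 1 \<mu>)" and ?s = "1 - 1 / real n"
  let ?A = "mechanism n r \<epsilon> \<eta>" and ?m = "\<lambda>y i. (\<Sum>j<n. y j i) / real n"
  let ?far = "\<lambda>j. {y \<in> space ?D. r\<^sup>2 / 4 < q (\<lambda>i. y j i - \<mu> i)}"
  have s: "0 < ?s" using n by simp
  interpret D: prob_space ?D by (intro prob_space_PiM prob_space_gauss) simp
  interpret G: prob_space "gauss ?s m" for m by (rule prob_space_gauss[OF s])
  have A: "?A \<in> ?D \<rightarrow>\<^sub>M prob_algebra (euclid d)"
    using n \<eta> by (intro measurable_mechanism) auto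
  have A01: "0 \<le> measure (?A y) S" "measure (?A y) S \<le> 1" for y S
  proof -
    interpret prob_space "?A y"
      unfolding mechanism_def using \<eta> s
      by (intro prob_space_mixture) (auto simp: accept_nonneg accept_le_1)
    show "0 \<le> measure (?A y) S" "measure (?A y) S \<le> 1" by simp_all
  qed
  have far_sets: "?far j \<in> sets ?D" if "j < n" for j
  proof -
    have [measurable]: "(\<lambda>y. q (\<lambda>i. y j i - \<mu> i)) \<in> borel_measurable ?D"
      using that by (intro measurable_bilin borel_measurable_diff measurable_data_coord borel_measurable_const) auto
    show ?thesis by measurable
  qed
  have far: "measure ?D (?far j) \<le> sqrt 2 ^ d * exp (- r\<^sup>2 / 16)" if "j < n" for j
  proof -
    let ?S = "{x \<in> space (euclid_lborel d). r\<^sup>2 / 4 < q (\<lambda>i. x i - \<mu> i)}"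
    have S: "?S \<in> sets (gauss 1 \<mu>)" unfolding sets_gauss by measurable
    have comp: "(\<lambda>y. y j) \<in> ?D \<rightarrow>\<^sub>M gauss 1 \<mu>"
      using that by (intro measurable_component_singleton) simp
    \<comment> \<open>Each sample has marginal \<open>gauss 1 \<mu>\<close>, so the tail bound
      applies with \<open>t = r\<^sup>2 / 4\<close>.\<close>
    have "measure (gauss 1 \<mu>) ?S = measure (distr ?D (gauss 1 \<mu>) (\<lambda>y. y j)) ?S"
      using that by (subst distr_PiM_component) (auto intro: prob_space_gauss)
    also have "\<dots> = measure ?D ((\<lambda>y. y j) -` ?S \<inter> space ?D)"
      by (rule measure_distr[OF comp S])
    also have "(\<lambda>y. y j) -` ?S \<inter> space ?D = ?far j"
      using measurable_space[OF comp] by auto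
    finally show ?thesis using gaussian_tail[of \<mu> "r\<^sup>2 / 4"] by simp
  qed
  define bad where "bad = (\<Union>j<n. ?far j)"
  have bad[measurable]: "bad \<in> sets ?D" unfolding bad_def using far_sets by auto
  have "measure ?D bad \<le> (\<Sum>j<n. measure ?D (?far j))"
    unfolding bad_def using far_sets by (intro D.finite_measure_subadditive_finite) auto
  also have "\<dots> \<le> (\<Sum>j<n. sqrt 2 ^ d * exp (- r\<^sup>2 / 16))"
    using far by (intro sum_mono) auto
  finally have bad_le: "measure ?D bad \<le> real n * (sqrt 2 ^ d * exp (- r\<^sup>2 / 16))" by simp
  have diff: "\<bar>measure (gauss ?s (?m y)) S - measure (?A y) S\<bar> \<le> indicator bad y + 2 * \<eta>"
    if y: "y \<in> space ?D" and S: "S \<in> sets (euclid_lborel d)" for y S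
  proof (cases "y \<in> bad")
    case True
    then have "indicator bad y = (1 :: real)" by simp
    then show ?thesis
      using A01[of y S] G.prob_le_1[of "?m y" S] measure_nonneg[of "gauss ?s (?m y)" S] \<eta>
      by linarith
  next
    case False
    then have near: "\<forall>j<n. q (\<lambda>i. y j i - \<mu> i) \<le> r\<^sup>2 / 4"
      using y by (auto simp: bad_def not_less)
    note cd = concentrated_dataset[OF n r, OF near]
    define p where "p = accept \<eta> (\<epsilon> * (total n r y - 3 / 4 * n) / 10)"
    have p: "0 \<le> p" "p \<le> 1" using \<eta> by (auto simp: p_def accept_nonneg accept_le_1)
    have mA: "measure (?A y) S = p * measure (gauss ?s (?m y)) S + (1 - p) * measure (gauss ?s (\<lambda>_. 0)) S"
      unfolding mechanism_def p_def[symmetric] by (subst cd(2)) (rule measure_mixture[OF p s S])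
    have "1 - 2 * \<eta> \<le> p"
      unfolding p_def using threshold \<eta> by (intro accept_ge) (auto simp: cd(1) algebra_simps)
    moreover have "measure (gauss ?s (?m y)) S - measure (?A y) S
        = (1 - p) * (measure (gauss ?s (?m y)) S - measure (gauss ?s (\<lambda>_. 0)) S)"
      unfolding mA by (simp add: algebra_simps)
    moreover have "\<bar>measure (gauss ?s (?m y)) S - measure (gauss ?s (\<lambda>_. 0)) S\<bar> \<le> 1"
      using G.prob_le_1[of "?m y" S] G.prob_le_1[of "\<lambda>_. 0" S]
        measure_nonneg[of "gauss ?s (?m y)" S] measure_nonneg[of "gauss ?s (\<lambda>_. 0)" S] by linarith
    ultimately have "\<bar>measure (gauss ?s (?m y)) S - measure (?A y) S\<bar> \<le> 1 - p"
      using p by (simp add: abs_mult mult_left_le)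
    then show ?thesis using \<open>1 - 2 * \<eta> \<le> p\<close> False by simp
  qed
  have "\<bar>measure (gauss 1 \<mu>) S - measure (output_dist n ?A (gauss 1 \<mu>)) S\<bar> \<le> \<alpha>"
    if S: "S \<in> sets (gauss 1 \<mu>)" for S
  proof -
    have S': "S \<in> sets (euclid_lborel d)" "S \<in> sets (euclid d)"
      using S by (auto simp: sets_euclid)
    have m: "(\<lambda>y. ?m y i) \<in> borel_measurable ?D" if "i < d" for i
      using that by (intro borel_measurable_divide borel_measurable_const
          borel_measurable_sum measurable_data_coord) auto
    have intG: "integrable ?D (\<lambda>y. measure (gauss ?s (?m y)) S)"
      by (intro D.integrable_const_bound[where B=1] measurable_measure_gauss m S'(1)) auto
    have intA: "integrable ?D (\<lambda>y. measure (?A y) S)"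
    proof (intro D.integrable_const_bound[where B=1])
      show "(\<lambda>y. measure (?A y) S) \<in> borel_measurable ?D"
        by (rule measurable_compose[OF A measurable_measure_prob_algebra[OF S'(2)]])
    qed (use A01 in auto)
    have int_bad: "integrable ?D (indicator bad :: _ \<Rightarrow> real)"
      using bad by (intro integrable_real_indicator) (auto simp: D.emeasure_eq_measure)
    have "measure (output_dist n ?A (gauss 1 \<mu>)) S = (\<integral>y. measure (?A y) S \<partial>?D)"
      unfolding output_dist_def
      by (rule D.measure_bind[OF measurable_prob_algebraD[OF A] S'(2)])
    then have "\<bar>measure (gauss 1 \<mu>) S - measure (output_dist n ?A (gauss 1 \<mu>)) S\<bar>
        = \<bar>\<integral>y. measure (gauss ?s (?m y)) S - measure (?A y) S \<partial>?D\<bar>"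
      using noisy_mean[OF n S'(1), of \<mu>] intG intA by simp
    also have "\<dots> \<le> (\<integral>y. \<bar>measure (gauss ?s (?m y)) S - measure (?A y) S\<bar> \<partial>?D)"
      by (rule integral_abs_bound)
    also have "\<dots> \<le> (\<integral>y. indicator bad y + 2 * \<eta> \<partial>?D)"
      using diff S'(1) intG intA int_bad
      by (intro integral_mono integrable_abs Bochner_Integration.integrable_diff
          Bochner_Integration.integrable_add) auto
    also have "\<dots> = measure ?D bad + 2 * \<eta>"
      using D.prob_space int_bad sets.Int_space_eq2[OF bad] by simp
    finally show ?thesis using bad_le \<alpha> by linarith
  qed
  then show ?thesis
    unfolding tv_dist_def by (intro cSUP_least) (use sets.top in blast)+
qed

end

section \<open>The quadratic form of the inverse covariance matrix\<close>

context
  fixes d :: nat and \<Sigma> :: "real mat"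
  assumes pd: "positive_definite d \<Sigma>"
begin

abbreviation "\<Sigma>i \<equiv> the (mat_inverse \<Sigma>)"

lemma cov_carrier: "\<Sigma> \<in> carrier_mat d d"
  and cov_sym: "transpose_mat \<Sigma> = \<Sigma>"
  and cov_pos: "v \<in> carrier_vec d \<Longrightarrow> v \<noteq> 0\<^sub>v d \<Longrightarrow> v \<bullet> (\<Sigma> *\<^sub>v v) > 0"
  using pd by (auto simp: positive_definite_def)

lemma cov_nonneg: "v \<in> carrier_vec d \<Longrightarrow> v \<bullet> (\<Sigma> *\<^sub>v v) \<ge> 0"
  using cov_pos[of v] cov_carrier by (cases "v = 0\<^sub>v d") (auto intro: less_imp_le)

text \<open>A nonzero kernel vector would contradict positive definiteness. Hence
  \<open>mat_inverse\<close> succeeds, and the \<open>the\<close> in \<open>gaussian_weight\<close>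
  denotes the true inverse.\<close>

lemma precision: "\<Sigma>i \<in> carrier_mat d d" "\<Sigma> * \<Sigma>i = 1\<^sub>m d" "\<Sigma>i * \<Sigma> = 1\<^sub>m d"
proof -
  have "det \<Sigma> \<noteq> 0"
  proof
    assume "det \<Sigma> = 0"
    then obtain v where "v \<in> carrier_vec d" "v \<noteq> 0\<^sub>v d" "\<Sigma> *\<^sub>v v = 0\<^sub>v d"
      using det_0_iff_vec_prod_zero_field[OF cov_carrier] by auto
    then show False using cov_pos[of v] by simp
  qed
  then have "\<Sigma> \<in> Units (ring_mat TYPE(real) d ())"
    by (rule det_non_zero_imp_unit[OF cov_carrier])
  then obtain P where "mat_inverse \<Sigma> = Some P"
    using mat_inverse(1)[OF cov_carrier] by (metis option.exhaust)
  then show "\<Sigma>i \<in> carrier_mat d d" "\<Sigma> * \<Sigma>i = 1\<^sub>m d" "\<Sigma>i * \<Sigma> = 1\<^sub>m d"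
    using mat_inverse(2)[OF cov_carrier] by auto
qed

text \<open>The transpose is a left inverse of the symmetric matrix \<Sigma>, and a left inverse
  equals the right inverse.\<close>

lemma precision_sym: "transpose_mat \<Sigma>i = \<Sigma>i"
proof -
  have "transpose_mat \<Sigma>i * \<Sigma> = 1\<^sub>m d"
    using transpose_mult[OF cov_carrier precision(1)] by (simp add: cov_sym precision(2))
  then have "transpose_mat \<Sigma>i * (\<Sigma> * \<Sigma>i) = \<Sigma>i"
    using assoc_mult_mat[of "transpose_mat \<Sigma>i" d d \<Sigma> d \<Sigma>i d] cov_carrier precision(1) by simp
  then show ?thesis using precision by simp
qed

lemma quadratic_form_eq_sum:
  "vec d x \<bullet> (\<Sigma>i *\<^sub>v vec d x) = (\<Sum>i<d. \<Sum>j<d. \<Sigma>i $$ (i, j) * x i * x j)"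
  using precision(1)
  by (simp add: scalar_prod_def mult_mat_vec_def atLeast0LessThan sum_distrib_left mult_ac)

text \<open>Nonnegativity of \<open>\<Sigma>\<close> at \<open>\<Sigma>\<^sup>-\<^sup>1 v - t e\<^sub>i\<close>.\<close>

lemma precision_lower_bound:
  assumes v: "v \<in> carrier_vec d" and i: "i < d"
  shows "2 * t * v $ i - t\<^sup>2 * \<Sigma> $$ (i, i) \<le> v \<bullet> (\<Sigma>i *\<^sub>v v)"
proof -
  define e where "e = (unit_vec d i :: real vec)"
  define u where "u = \<Sigma>i *\<^sub>v v"
  have c: "e \<in> carrier_vec d" "u \<in> carrier_vec d" "\<Sigma> *\<^sub>v e \<in> carrier_vec d"
    using cov_carrier precision(1) v by (auto simp: e_def u_def)
  have \<Sigma>u: "\<Sigma> *\<^sub>v u = v"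
    unfolding u_def using assoc_mult_mat_vec[OF cov_carrier precision(1) v] v by (simp add: precision(2))
  have uv: "u \<bullet> v = v \<bullet> u" using c v by (intro comm_scalar_prod)
  have ev: "e \<bullet> v = v $ i" using v i by (simp add: e_def scalar_prod_left_unit)
  have ue: "u \<bullet> (\<Sigma> *\<^sub>v e) = v $ i"
    using transpose_vec_mult_scalar[OF cov_carrier c(1,2)] comm_scalar_prod[OF c(1) v] ev
    by (simp add: cov_sym \<Sigma>u)
  have ee: "e \<bullet> (\<Sigma> *\<^sub>v e) = \<Sigma> $$ (i, i)"
    using cov_carrier i by (simp add: e_def scalar_prod_left_unit scalar_prod_right_unit)
  have "0 \<le> (u - t \<cdot>\<^sub>v e) \<bullet> (\<Sigma> *\<^sub>v (u - t \<cdot>\<^sub>v e))"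
    using c by (intro cov_nonneg) auto
  also have "\<Sigma> *\<^sub>v (u - t \<cdot>\<^sub>v e) = v - t \<cdot>\<^sub>v (\<Sigma> *\<^sub>v e)"
    using c cov_carrier by (simp add: mult_minus_distrib_mat_vec[OF cov_carrier] mult_mat_vec[OF cov_carrier] \<Sigma>u)
  also have "(u - t \<cdot>\<^sub>v e) \<bullet> (v - t \<cdot>\<^sub>v (\<Sigma> *\<^sub>v e))
      = u \<bullet> v - t * (u \<bullet> (\<Sigma> *\<^sub>v e)) - t * (e \<bullet> v) + t\<^sup>2 * (e \<bullet> (\<Sigma> *\<^sub>v e))"
    using c v by (simp add: minus_scalar_prod_distrib[of _ d] scalar_prod_minus_distrib[of _ d]
        power2_eq_square algebra_simps)
  finally show ?thesis by (simp add: uv ev ue ee flip: u_def)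
qed

text \<open>Coercivity comes from the diagonal of \<Sigma> alone, without eigenvalues: each
  \<open>(x i)\<^sup>2 / D\<close> is below the form, and summing over the \<open>d\<close>
  coordinates yields the constant \<open>1 / (D * d)\<close>.\<close>

lemma pd_form_precision:
  assumes "1 \<le> d"
  shows "pd_form d (\<lambda>i j. \<Sigma>i $$ (i, j))"
proof
  fix i j assume "i < d" "j < d"
  then show "\<Sigma>i $$ (i, j) = \<Sigma>i $$ (j, i)"
    using precision(1) precision_sym by (metis carrier_matD index_transpose_mat(1))
next
  have diag: "0 \<le> \<Sigma> $$ (i, i)" if "i < d" for i
    using precision_lower_bound[of "0\<^sub>v d" i 1] that precision(1) by simp
  \<comment> \<open>The trace bounds every diagonal entry; the added 1 makes positivity
    immediate.\<close>
  define D where "D = 1 + (\<Sum>i<d. \<Sigma> $$ (i, i))"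
  have D: "0 < D" using diag by (auto simp: D_def intro!: add_pos_nonneg sum_nonneg)
  have Dge: "\<Sigma> $$ (i, i) \<le> D" if "i < d" for i
    using member_le_sum[of i "{..<d}" "\<lambda>i. \<Sigma> $$ (i, i)"] that diag by (simp add: D_def)
  have "1 / (D * d) * (\<Sum>i<d. (x i)\<^sup>2) \<le> (\<Sum>i<d. \<Sum>j<d. \<Sigma>i $$ (i, j) * x i * x j)" (is "_ \<le> ?Q") for x
  proof -
    have "(x i)\<^sup>2 / D \<le> ?Q" if i: "i < d" for i
    proof -
      \<comment> \<open>The value \<open>t = x i / D\<close> maximizes
        \<open>2 * t * x i - t\<^sup>2 * D\<close>, the lower bound with the diagonal entry replaced
        by \<open>D\<close>.\<close>
      have "(x i)\<^sup>2 / D = 2 * (x i / D) * x i - (x i / D)\<^sup>2 * D"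
        using D by (simp add: power2_eq_square field_simps)
      also have "\<dots> \<le> 2 * (x i / D) * x i - (x i / D)\<^sup>2 * \<Sigma> $$ (i, i)"
        using Dge[OF i] by (intro diff_left_mono mult_left_mono) auto
      also have "\<dots> \<le> ?Q"
        using precision_lower_bound[of "vec d x" i "x i / D"] i by (simp add: quadratic_form_eq_sum)
      finally show ?thesis .
    qed
    then have "(\<Sum>i<d. (x i)\<^sup>2 / D) \<le> (\<Sum>i<d. ?Q)" by (intro sum_mono) auto
    then show ?thesis using assms D by (simp add: sum_divide_distrib[symmetric] field_simps)
  qed
  moreover have "0 < 1 / (D * d)" using D assms by simp
  ultimately show "\<exists>c>0. \<forall>x. c * (\<Sum>i<d. (x i)\<^sup>2) \<le> (\<Sum>i<d. \<Sum>j<d. \<Sigma>i $$ (i, j) * x i * x j)"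
    by blast
qed

text \<open>By translation invariance the normalizing integral in \<open>gaussian\<close> does not
  depend on \<mu>.\<close>

lemma gaussian_eq_gauss:
  assumes "1 \<le> d"
  shows "gaussian d \<mu> \<Sigma> = pd_form.gauss d (\<lambda>i j. \<Sigma>i $$ (i, j)) 1 \<mu>"
proof -
  interpret pd_form d "\<lambda>i j. \<Sigma>i $$ (i, j)" by (rule pd_form_precision[OF assms])
  have w: "gaussian_weight d \<mu> \<Sigma> x = exp (- q (\<lambda>i. x i - \<mu> i) / (2 * 1))" for x
    by (simp add: gaussian_weight_def Let_def quadratic_form_eq_sum bilin_def)
  have "(\<integral>x. gaussian_weight d \<mu> \<Sigma> x \<partial>euclid_lborel d) = gauss_mass 1"
    unfolding w using nn_integral_exp_q[of 1 \<mu>] gauss_mass_pos[of 1]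
    by (subst integral_eq_nn_integral) auto
  then show ?thesis
    unfolding gaussian_def gauss_def gauss_dens_def w by simp
qed

end

section \<open>Choice of the parameters\<close>

text \<open>Every quantity under a logarithm is bounded by a power of
  \<open>x = d / (\<delta> * \<epsilon> * \<alpha>) \<ge> 4\<close>, so each logarithm is at most a
  constant times \<Lambda>.\<close>

lemma parameters_suffice:
  fixes \<epsilon> \<delta> \<alpha> :: real and d :: nat
  defines "\<Lambda> \<equiv> ln (real d / (\<delta> * \<epsilon> * \<alpha>))"
  defines "n \<equiv> nat \<lceil>10560 * (sqrt d * \<Lambda>\<^sup>2 / \<epsilon>)\<rceil>" and "r \<equiv> 20 * sqrt d * \<Lambda>" and "\<eta> \<equiv> \<delta> * \<alpha> / 4"
    and "l \<equiv> 4 * ln (4 / \<delta>) / \<epsilon>"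
  assumes d: "1 \<le> d" and \<epsilon>: "\<epsilon> \<in> {0<..1}" and \<delta>: "\<delta> \<in> {0<..1/2}" and \<alpha>: "\<alpha> \<in> {0<..1/2}"
  shows "real n \<le> 10561 * (sqrt d / \<epsilon> * \<Lambda>\<^sup>2)"
    and "2 \<le> n" and "0 \<le> r" and "0 \<le> l"
    and "- 40 * ln \<eta> \<le> \<epsilon> * n"
    and "exp (l * (l + 1) * (44 * r / n)\<^sup>2 - l * (\<epsilon> / 2)) \<le> \<delta> / 4"
    and "real n * (sqrt 2 ^ d * exp (- r\<^sup>2 / 16)) + 2 * \<eta> \<le> \<alpha>"
proof -
  define x where "x = real d / (\<delta> * \<epsilon> * \<alpha>)"
  have pos: "0 < \<epsilon>" "\<epsilon> \<le> 1" "0 < \<delta>" "\<delta> \<le> 1/2" "0 < \<alpha>" "\<alpha> \<le> 1/2" "1 \<le> real d"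
    using d \<epsilon> \<delta> \<alpha> by auto
  have \<delta>\<alpha>: "\<delta> * \<alpha> \<le> 1 / 2 * (1 / 2)" using pos by (intro mult_mono) auto
  have p1: "\<delta> * \<epsilon> * \<alpha> \<le> \<delta> * \<alpha>" "\<delta> * \<epsilon> * \<alpha> \<le> \<epsilon>" "\<delta> * \<epsilon> * \<alpha> \<le> \<alpha>" "\<delta> * \<epsilon> * \<alpha> \<le> \<delta>"
  proof -
    show "\<delta> * \<epsilon> * \<alpha> \<le> \<delta> * \<alpha>" using pos by (simp add: mult_left_le_one_le)
    also have "\<delta> * \<alpha> \<le> \<alpha>" using pos by (simp add: mult_left_le_one_le)
    finally show "\<delta> * \<epsilon> * \<alpha> \<le> \<alpha>" .
    have "\<delta> * \<epsilon> * \<alpha> = \<epsilon> * (\<delta> * \<alpha>)" by simp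
    also have "\<dots> \<le> \<epsilon> * 1" using pos \<delta>\<alpha> by (intro mult_left_mono) auto
    finally show "\<delta> * \<epsilon> * \<alpha> \<le> \<epsilon>" by simp
    have "\<delta> * \<epsilon> * \<alpha> \<le> \<delta> * \<alpha>" by fact
    also have "\<delta> * \<alpha> \<le> \<delta>" using pos by (simp add: mult_left_le)
    finally show "\<delta> * \<epsilon> * \<alpha> \<le> \<delta>" .
  qed
  have prod_pos: "0 < \<delta> * \<epsilon> * \<alpha>" using pos by simp
  have le_x: "1 / c \<le> x" if "\<delta> * \<epsilon> * \<alpha> \<le> c" for c
    unfolding x_def using pos that prod_pos by (intro frac_le) auto
  have x\<delta>\<alpha>: "1 / (\<delta> * \<alpha>) \<le> x" and x\<epsilon>: "1 / \<epsilon> \<le> x" and x\<alpha>: "1 / \<alpha> \<le> x" and x\<delta>: "1 / \<delta> \<le> x"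
    using p1 by (auto intro: le_x)
  have x4: "4 \<le> x"
  proof -
    have "4 \<le> 1 / (\<delta> * \<alpha>)" using \<delta>\<alpha> pos by (simp add: field_simps)
    then show ?thesis using x\<delta>\<alpha> by linarith
  qed
  have dx: "real d \<le> x"
  proof -
    have "real d / 1 \<le> x"
      unfolding x_def using prod_pos pos p1(2) by (intro frac_le) linarith+
    then show ?thesis by simp
  qed
  have \<Lambda>: "\<Lambda> = ln x" by (simp add: \<Lambda>_def x_def)
  have \<Lambda>1: "1 \<le> \<Lambda>"
  proof -
    have "exp 1 \<le> x" using e_less_272 x4 by linarith
    then show ?thesis unfolding \<Lambda> using x4 by (subst ln_ge_iff) auto
  qed
  have \<Lambda>x: "\<Lambda> \<le> x" unfolding \<Lambda> using ln_le_minus_one[of x] x4 by linarith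
  \<comment> \<open>The factor 4 is absorbed by another \<open>x\<close>, at the price of doubling
    \<Lambda>.\<close>
  have ln4: "ln (4 * y) \<le> 2 * \<Lambda>" if "0 < y" "y \<le> x" for y
  proof -
    have "ln (4 * y) \<le> ln (x * x)"
      using that x4 by (intro ln_mono mult_mono) auto
    then show ?thesis using x4 by (simp add: ln_mult \<Lambda>)
  qed
  define a where "a = sqrt d * \<Lambda>\<^sup>2 / \<epsilon>"
  have sd: "1 \<le> sqrt d" using d by simp
  have a1: "\<Lambda> / \<epsilon> \<le> a" "1 \<le> a"
  proof -
    have "1 * \<Lambda> \<le> sqrt d * \<Lambda>\<^sup>2"
      using sd \<Lambda>1 by (intro mult_mono) (auto simp: power2_eq_square)
    then show *: "\<Lambda> / \<epsilon> \<le> a"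
      unfolding a_def using pos by (intro divide_right_mono) auto
    have "1 \<le> \<Lambda> / \<epsilon>" using \<Lambda>1 pos by simp
    with * show "1 \<le> a" by linarith
  qed
  have n_def': "n = nat \<lceil>10560 * a\<rceil>" by (simp add: n_def a_def)
  \<comment> \<open>Rounding up adds less than 1, which is at most \<open>a\<close>; this accounts
    for 10561.\<close>
  have n_ge: "10560 * a \<le> n" and n_le: "n \<le> 10561 * a"
    unfolding n_def' using a1 by linarith+
  show "real n \<le> 10561 * (sqrt d / \<epsilon> * \<Lambda>\<^sup>2)"
    using n_le by (simp add: a_def)
  show n2: "2 \<le> n" using n_ge a1 by linarith
  then have npos: "0 < real n" by simp
  show r0: "0 \<le> r" using \<Lambda>1 by (simp add: r_def)
  define L where "L = ln (4 / \<delta>)"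
  have L: "1 \<le> L" "L \<le> 2 * \<Lambda>"
  proof -
    have "exp 1 * \<delta> \<le> exp 1 * 1" using pos by (intro mult_left_mono) auto
    then have "exp 1 * \<delta> \<le> 4" using e_less_272 by linarith
    then have "exp 1 \<le> 4 / \<delta>" using pos by (simp add: pos_le_divide_eq)
    then show "1 \<le> L" unfolding L_def using pos by (subst ln_ge_iff) auto
    show "L \<le> 2 * \<Lambda>" unfolding L_def using ln4[of "1 / \<delta>"] x\<delta> pos by simp
  qed
  have lL: "l = 4 * L / \<epsilon>" by (simp add: l_def L_def)
  have l1: "1 \<le> l" unfolding lL using L pos by (simp add: field_simps)
  then show "0 \<le> l" by simp
  have \<eta>4: "1 / \<eta> = 4 * (1 / (\<delta> * \<alpha>))" by (simp add: \<eta>_def)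
  show "- 40 * ln \<eta> \<le> \<epsilon> * n"
  proof -
    have "- ln \<eta> = ln (1 / \<eta>)" using pos by (simp add: \<eta>_def ln_div)
    also have "\<dots> \<le> 2 * \<Lambda>" unfolding \<eta>4 using x\<delta>\<alpha> pos by (intro ln4) auto
    finally have "- 40 * ln \<eta> \<le> 80 * \<Lambda>" by simp
    also have "\<dots> \<le> 10560 * \<Lambda>" using \<Lambda>1 by simp
    also have "\<dots> = \<epsilon> * (10560 * (\<Lambda> / \<epsilon>))" using pos by simp
    also have "\<dots> \<le> \<epsilon> * n" using a1 n_ge pos by (intro mult_left_mono) auto
    finally show ?thesis .
  qed
  show "exp (l * (l + 1) * (44 * r / n)\<^sup>2 - l * (\<epsilon> / 2)) \<le> \<delta> / 4"
  proof -
    \<comment> \<open>\<open>264 r L / \<epsilon>\<close> samples suffice here, and \<open>10560 = 264 * 20 * 2\<close> by \<open>r = 20 sqrt d \<Lambda>\<close> and \<open>L \<le> 2 \<Lambda>\<close>.\<close>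
    have "264 * r * L / \<epsilon> \<le> 264 * r * (2 * \<Lambda>) / \<epsilon>"
      using L r0 pos by (intro divide_right_mono mult_left_mono) auto
    also have "\<dots> = 10560 * a" by (simp add: a_def r_def power2_eq_square)
    finally have "264 * r * L / \<epsilon> \<le> n" using n_ge by linarith
    then have "6 * L * (44 * r / n) \<le> \<epsilon>"
      using npos pos by (simp add: field_simps)
    then have "(6 * L * (44 * r / n))\<^sup>2 \<le> \<epsilon>\<^sup>2"
      using L r0 npos by (intro power_mono) auto
    then have 1: "36 * (L\<^sup>2 * (44 * r / n)\<^sup>2) \<le> \<epsilon>\<^sup>2"
      by (simp add: power_mult_distrib power_divide)
    \<comment> \<open>Here \<open>l + 1 \<le> 2 * l\<close>, and
      \<open>l = 4 * L / \<epsilon>\<close> gives the factor \<open>2 * 16 = 32\<close>, which fits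
      below the available 36.\<close>
    have "l * (l + 1) * (44 * r / n)\<^sup>2 \<le> l * (2 * l) * (44 * r / n)\<^sup>2"
      using l1 by (intro mult_right_mono mult_left_mono) auto
    also have "\<dots> = 32 * (L\<^sup>2 * (44 * r / n)\<^sup>2) / \<epsilon>\<^sup>2"
      by (simp add: lL power2_eq_square)
    also have "\<dots> \<le> 36 * (L\<^sup>2 * (44 * r / n)\<^sup>2) / \<epsilon>\<^sup>2"
      by (intro divide_right_mono mult_right_mono) auto
    also have "\<dots> \<le> 1" using 1 pos by simp
    \<comment> \<open>The choice of \<open>l\<close> makes the linear term \<open>2 * L\<close>:
      half of it absorbs the quadratic remainder, as \<open>L \<ge> 1\<close>, and the other half
      produces \<open>\<delta> / 4\<close>.\<close>
    finally have "l * (l + 1) * (44 * r / n)\<^sup>2 - l * (\<epsilon> / 2) \<le> 1 - 2 * L"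
      using pos by (simp add: lL)
    also have "\<dots> \<le> - L" using L by simp
    finally have "exp (l * (l + 1) * (44 * r / n)\<^sup>2 - l * (\<epsilon> / 2)) \<le> exp (- L)" by simp
    also have "exp (- L) = \<delta> / 4" using pos by (simp add: L_def exp_minus)
    finally show ?thesis .
  qed
  show "real n * (sqrt 2 ^ d * exp (- r\<^sup>2 / 16)) + 2 * \<eta> \<le> \<alpha>"
  proof -
    have "a \<le> x * x\<^sup>2 * x"
    proof -
      have "sqrt d * 1 \<le> sqrt d * sqrt d" using sd by (intro mult_left_mono) auto
      then have "sqrt d \<le> x" using dx by simp
      moreover have "\<Lambda>\<^sup>2 \<le> x\<^sup>2" using \<Lambda>x \<Lambda>1 by (intro power_mono) auto
      ultimately have "sqrt d * \<Lambda>\<^sup>2 * (1 / \<epsilon>) \<le> x * x\<^sup>2 * x"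
        using x\<epsilon> x4 pos by (intro mult_mono) auto
      then show ?thesis by (simp add: a_def)
    qed
    then have "2 * real n \<le> 2 * 10561 * x ^ 4"
      using n_le by (simp add: power2_eq_square power4_eq_xxxx mult.assoc)
    \<comment> \<open>The numerical constant is at most \<open>4 ^ 8 = 65536\<close>. With one more
      factor \<open>x\<close> for \<open>1 / \<alpha>\<close>, the power becomes
      \<open>x ^ 13 = exp (13 * \<Lambda>)\<close>.\<close>
    also have "\<dots> \<le> x ^ 8 * x ^ 4"
      using x4 power_mono[of 4 x 8] by (intro mult_right_mono) auto
    finally have x12: "2 * real n \<le> x ^ 8 * x ^ 4" .
    have "2 * real n * (1 / \<alpha>) \<le> x ^ 8 * x ^ 4 * x"
      using x4 pos by (intro mult_mono[OF x12 x\<alpha>]) auto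
    also have "\<dots> = exp (13 * \<Lambda>)"
    proof -
      have "exp (13 * \<Lambda>) = x ^ 13"
        using exp_of_nat_mult[of 13 \<Lambda>] x4 by (simp add: \<Lambda>)
      then show ?thesis by (simp flip: power_add power_Suc2)
    qed
    finally have n\<alpha>: "2 * real n \<le> \<alpha> * exp (13 * \<Lambda>)"
      using pos by (simp add: field_simps)
    have "sqrt 2 \<le> exp 1"
      using exp_ge_add_one_self[of 1] real_sqrt_le_mono[of 2 4] by simp
    then have "sqrt 2 ^ d \<le> exp 1 ^ d" by (intro power_mono) auto
    also have "exp 1 ^ d = exp (real d)" by (simp flip: exp_of_nat_mult)
    finally have s2: "sqrt 2 ^ d \<le> exp (real d)" .
    have rr: "r\<^sup>2 / 16 = 25 * (d * \<Lambda>\<^sup>2)" by (simp add: r_def power_mult_distrib)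
    have "\<Lambda> \<le> \<Lambda>\<^sup>2" using \<Lambda>1 by (simp add: power2_eq_square)
    then have "1 * \<Lambda> \<le> real d * \<Lambda>\<^sup>2" "real d * 1 \<le> real d * \<Lambda>\<^sup>2"
      using pos \<Lambda>1 by (intro mult_mono; simp)+
    moreover have "0 \<le> real d * \<Lambda>\<^sup>2" by simp
    \<comment> \<open>Both terms on the left are controlled by \<open>d * \<Lambda>\<^sup>2\<close>,
      with total coefficient 14, while the tail exponent has coefficient 25.\<close>
    ultimately have "13 * \<Lambda> + d \<le> r\<^sup>2 / 16" unfolding rr by linarith
    have "2 * real n * (sqrt 2 ^ d * exp (- r\<^sup>2 / 16))
        \<le> \<alpha> * exp (13 * \<Lambda>) * (exp (real d) * exp (- r\<^sup>2 / 16))"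
      using pos by (intro mult_mono[OF n\<alpha>] mult_right_mono[OF s2]) auto
    also have "\<dots> = \<alpha> * exp (13 * \<Lambda> + d - r\<^sup>2 / 16)"
      by (simp add: mult_exp_exp mult.assoc)
    also have "\<dots> \<le> \<alpha> * 1"
      using \<open>13 * \<Lambda> + d \<le> r\<^sup>2 / 16\<close> pos by (intro mult_left_mono) auto
    finally have "real n * (sqrt 2 ^ d * exp (- r\<^sup>2 / 16)) \<le> \<alpha> / 2" by simp
    moreover have "2 * \<eta> \<le> \<alpha> / 2"
      using mult_right_mono[of \<delta> 1 \<alpha>] pos by (simp add: \<eta>_def)
    ultimately show ?thesis by simp
  qed
qed

theorem theorem2:
  shows "\<exists>(C::real) g. C > 0 \<and> polylog g \<and>
    (\<forall>(d::nat) (\<Sigma>::real mat) (\<epsilon>::real) (\<delta>::real) (\<alpha>::real).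
       d \<ge> 1 \<longrightarrow> positive_definite d \<Sigma> \<longrightarrow>
       \<epsilon> \<in> {0<..1} \<longrightarrow> \<delta> \<in> {0<..1/2} \<longrightarrow> \<alpha> \<in> {0<..1/2} \<longrightarrow>
       (\<exists>(n::nat) A.
          real n \<le> C * (sqrt (real d) / \<epsilon> * g (real d / (\<delta> * \<epsilon> * \<alpha>))) \<and>
          accurate_sampler (euclid d) n (gaussian_class d \<Sigma>) \<alpha> A \<and>
          differentially_private (euclid d) n (euclid d) \<epsilon> \<delta> A))"
proof (intro exI conjI allI impI)
  show "(0::real) < 10561" by simp
  \<comment> \<open>The polynomial \<open>X\<^sup>2\<close> bounds the squared logarithm with
    equality.\<close>
  show "polylog (\<lambda>x. (ln x)\<^sup>2)"
    unfolding polylog_def by (rule exI[of _ "monom 1 2"]) (simp add: poly_monom)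
next
  fix d :: nat and \<Sigma> :: "real mat" and \<epsilon> \<delta> \<alpha> :: real
  assume d: "1 \<le> d" and pd: "positive_definite d \<Sigma>"
    and \<epsilon>: "\<epsilon> \<in> {0<..1}" and \<delta>: "\<delta> \<in> {0<..1/2}" and \<alpha>: "\<alpha> \<in> {0<..1/2}"
  interpret pd_form d "\<lambda>i j. the (mat_inverse \<Sigma>) $$ (i, j)"
    by (rule pd_form_precision[OF pd d])
  let ?lg = "ln (real d / (\<delta> * \<epsilon> * \<alpha>))"
  let ?n = "nat \<lceil>10560 * (sqrt d * ?lg\<^sup>2 / \<epsilon>)\<rceil>"
  let ?A = "mechanism ?n (20 * sqrt d * ?lg) \<epsilon> (\<delta> * \<alpha> / 4)"
  note par = parameters_suffice[OF d \<epsilon> \<delta> \<alpha>]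
  have \<eta>: "0 < \<delta> * \<alpha> / 4" "\<delta> * \<alpha> / 4 \<le> \<delta> / 4"
    using \<delta> \<alpha> by (auto simp: mult_left_le)
  show "real ?n \<le> 10561 * (sqrt (real d) / \<epsilon> * ?lg\<^sup>2)"
    by (rule par(1))
  have "tv_dist D (output_dist ?n ?A D) \<le> \<alpha>" if "D \<in> gaussian_class d \<Sigma>" for D
    using that mechanism_accurate[OF par(2,3) \<eta>(1) par(5,7)]
    by (auto simp: gaussian_class_def gaussian_eq_gauss[OF pd d])
  moreover have "?A \<in> datasets (euclid d) ?n \<rightarrow>\<^sub>M prob_algebra (euclid d)"
    using par(2) \<eta>(1) by (intro measurable_mechanism sets_euclid) auto
  ultimately show "accurate_sampler (euclid d) ?n (gaussian_class d \<Sigma>) \<alpha> ?A"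
    by (simp add: accurate_sampler_def randomized_algorithm_def)
  show "differentially_private (euclid d) ?n (euclid d) \<epsilon> \<delta> ?A"
    using \<epsilon> by (intro mechanism_private[OF par(2,3) _ _ \<eta> par(5,4,6)]) auto
qed

end
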